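(* Let $\alpha$ be an endomorphism of a unital $C^*$-algebra $A$, and let $L$ be a transfer operator for $(A,\alpha)$. The pair $(j_A,T):=(Q\circ i_A,Q(S))$ is a covariant representation of $(A,\alpha,L)$ in $A\rtimes_{\alpha,L}\mathbb{N}$, and for every covariant representation $(\rho,V)$ of $(A,\alpha,L)$ (in a $C^*$-algebra $B$), there is a representation ($*$-homomorphism) $\tau_{\rho,V}:A\rtimes_{\alpha,L}\mathbb{N}\to B$ such that $\tau_{\rho,V}\circ j_A=\rho$ and $\tau_{\rho,V}(T)=V$.
   Context: Endomorphisms are $*$-homomorphisms $\alpha:A\to A$, not assumed unital or injective. A transfer operator for $(A,\alpha)$ is a continuous linear map $L:A\to A$ that is positive ($a\ge 0\Rightarrow L(a)\ge 0$) and satisfies $L(\alpha(a)b)=aL(b)$ for all $a,b\in A$. A Toeplitz-covariant representation $(\rho,V)$ of $(A,\alpha,L)$ in a $C^*$-algebra $B$ is a unital homomorphism $\rho:A\to B$ and an element $V\in B$ with $V\rho(a)=\rho(\alpha(a))V$ and $V^*\rho(a)V=\rho(L(a))$ for all $a\in A$. $\mathcal{T}(A,\alpha,L)$ is the universal unital $C^*$-algebra generated by a Toeplitz-covariant representation $(i_A,S)$; $i_A$ is injective. The bimodule $M_L$: let $A_L$ be a copy of the vector space $A$ with right action $m\cdot a=m\alpha(a)$ and $A$-valued form $\langle m,n\rangle_L=L(m^*n)$; let $N=\{a\in A_L:\langle a,a\rangle_L=0\}$, let $q:A_L\to A_L/N$ be the quotient map, and let $M_L$ be the right Hilbert $A$-module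 obtained by completing $A_L/N$, with left action $\phi:A\to\mathcal{L}(M_L)$, $\phi(a)q(b)=q(ab)$. Let $\Theta_{x,y}(z)=x\cdot\langle y,z\rangle_L$, let $\mathcal{K}(M_L)$ be the closed span of the $\Theta_{x,y}$, let $J(M_L):=\phi^{-1}(\mathcal{K}(M_L))$, and let $K_\alpha:=\overline{A\alpha(A)A}\cap J(M_L)$, where $\overline{A\alpha(A)A}$ is the closed linear span of the products $a\alpha(b)c$. A Toeplitz representation $(\psi,\pi)$ of $M_L$ in $B$ is a linear map $\psi:M_L\to B$ and a homomorphism $\pi:A\to B$ with $\psi(x\cdot a)=\psi(x)\pi(a)$, $\psi(x)^*\psi(y)=\pi(\langle x,y\rangle_L)$, $\psi(\phi(a)x)=\pi(a)\psi(x)$; it induces a homomorphism $(\psi,\pi)^{(1)}:\mathcal{K}(M_L)\to B$ with $(\psi,\pi)^{(1)}(\Theta_{x,y})=\psi(x)\psi(y)^*$. Every Toeplitz-covariant representation $(\rho,V)$ gives a Toeplitz representation $(\psi_V,\rho)$ of $M_L$, where $\psi_V$ is the bounded linear map with $\psi_V(q(a))=\rho(a)V$. A covariant representation of $(A,\alpha,L)$ is a Toeplitz-covariant representation $(\rho,V)$ which in addition satisfies $\rho(a)=(\psi_V,\rho)^{(1)}(\phi(a))$ for all $a\in K_\alpha$. Crossed product: a redundancy is a pair $(i_A(a),k)$ with $a\in A$, $k\in\overline{i_A(A)SS^*i_A(A)}$ (closed linear span) and $i_A(a)i_A(b)S=k\,i_A(b)S$ for all $b\in A$. Exel's crossed product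 $A\rtimes_{\alpha,L}\mathbb{N}$ is the quotient of $\mathcal{T}(A,\alpha,L)$ by the closed two-sided ideal generated by $\{i_A(a)-k: (i_A(a),k)\text{ is a redundancy with } a\in\overline{A\alpha(A)A}\}$, and $Q:\mathcal{T}(A,\alpha,L)\to A\rtimes_{\alpha,L}\mathbb{N}$ is the quotient map. *)

theory Defs
  imports "HOL-Analysis.Analysis" "HOL-Algebra.QuotRing"
begin

section \<open>Unital C*-algebras\<close>

text \<open>The zero algebra is allowed (there is no axiom \<open>0 \<noteq> 1\<close>, which is why
  the class is not built on \<open>real_normed_algebra_1\<close>): Exel's crossed product can be zero.\<close>

class unital_cstar_algebra = real_normed_algebra + banach + monoid_mult +
  fixes scaleC :: "complex \<Rightarrow> 'a \<Rightarrow> 'a"  (infixr "*\<^sub>C" 75)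
    and adj :: "'a \<Rightarrow> 'a"
  assumes scaleR_eq_scaleC: "r *\<^sub>R x = complex_of_real r *\<^sub>C x"
    and scaleC_add_right: "c *\<^sub>C (x + y) = c *\<^sub>C x + c *\<^sub>C y"
    and scaleC_add_left: "(c + d) *\<^sub>C x = c *\<^sub>C x + d *\<^sub>C x"
    and scaleC_scaleC: "c *\<^sub>C d *\<^sub>C x = (c * d) *\<^sub>C x"
    and mult_scaleC_left: "(c *\<^sub>C x) * y = c *\<^sub>C (x * y)"
    and mult_scaleC_right: "x * (c *\<^sub>C y) = c *\<^sub>C (x * y)"
    and norm_scaleC: "norm (c *\<^sub>C x) = cmod c * norm x"
    and adj_adj: "adj (adj x) = x"
    and adj_add: "adj (x + y) = adj x + adj y"
    and adj_scaleC: "adj (c *\<^sub>C x) = cnj c *\<^sub>C adj x"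
    and adj_mult: "adj (x * y) = adj y * adj x"
    and norm_adj_mult_self: "norm (adj x * x) = (norm x)\<^sup>2"

text \<open>Quotients by ideals are not available as types, so the C*-algebras in which representations
  take their values are structures on a carrier set.\<close>

record 'b cstar = "'b ring" +
  cscale :: "complex \<Rightarrow> 'b \<Rightarrow> 'b"
  cadj :: "'b \<Rightarrow> 'b"
  cnorm :: "'b \<Rightarrow> real"

locale unital_cstar = ring B for B :: "'b cstar" (structure) +
  assumes cscale_closed: "x \<in> carrier B \<Longrightarrow> cscale B c x \<in> carrier B"
    and cscale_add_right:
      "x \<in> carrier B \<Longrightarrow> y \<in> carrier B \<Longrightarrow> cscale B c (x \<oplus> y) = cscale B c x \<oplus> cscale B c y"
    and cscale_add_left: "x \<in> carrier B \<Longrightarrow> cscale B (c + d) x = cscale B c x \<oplus> cscale B d x"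
    and cscale_cscale: "x \<in> carrier B \<Longrightarrow> cscale B c (cscale B d x) = cscale B (c * d) x"
    and cscale_one: "x \<in> carrier B \<Longrightarrow> cscale B 1 x = x"
    and cscale_mult_left:
      "x \<in> carrier B \<Longrightarrow> y \<in> carrier B \<Longrightarrow> cscale B c x \<otimes> y = cscale B c (x \<otimes> y)"
    and cscale_mult_right:
      "x \<in> carrier B \<Longrightarrow> y \<in> carrier B \<Longrightarrow> x \<otimes> cscale B c y = cscale B c (x \<otimes> y)"
    and cadj_closed: "x \<in> carrier B \<Longrightarrow> cadj B x \<in> carrier B"
    and cadj_cadj: "x \<in> carrier B \<Longrightarrow> cadj B (cadj B x) = x"
    and cadj_add: "x \<in> carrier B \<Longrightarrow> y \<in> carrier B \<Longrightarrow> cadj B (x \<oplus> y) = cadj B x \<oplus> cadj B y"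
    and cadj_cscale: "x \<in> carrier B \<Longrightarrow> cadj B (cscale B c x) = cscale B (cnj c) (cadj B x)"
    and cadj_mult: "x \<in> carrier B \<Longrightarrow> y \<in> carrier B \<Longrightarrow> cadj B (x \<otimes> y) = cadj B y \<otimes> cadj B x"
    and cnorm_eq_0_iff: "x \<in> carrier B \<Longrightarrow> cnorm B x = 0 \<longleftrightarrow> x = \<zero>"
    and cnorm_triangle: "x \<in> carrier B \<Longrightarrow> y \<in> carrier B \<Longrightarrow> cnorm B (x \<oplus> y) \<le> cnorm B x + cnorm B y"
    and cnorm_cscale: "x \<in> carrier B \<Longrightarrow> cnorm B (cscale B c x) = cmod c * cnorm B x"
    and cnorm_mult: "x \<in> carrier B \<Longrightarrow> y \<in> carrier B \<Longrightarrow> cnorm B (x \<otimes> y) \<le> cnorm B x * cnorm B y"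
    and cnorm_cadj_mult_self: "x \<in> carrier B \<Longrightarrow> cnorm B (cadj B x \<otimes> x) = (cnorm B x)\<^sup>2"
    and cnorm_complete:
      "range f \<subseteq> carrier B \<Longrightarrow>
        \<forall>e>0. \<exists>N. \<forall>m\<ge>N. \<forall>n\<ge>N. cnorm B (f m \<ominus> f n) < e \<Longrightarrow>
        \<exists>l\<in>carrier B. (\<lambda>n. cnorm B (f n \<ominus> l)) \<longlonglongrightarrow> 0"

definition type_cstar :: "'a::unital_cstar_algebra cstar" where
  "type_cstar = \<lparr>carrier = UNIV, mult = (*), one = 1, zero = 0, add = (+),
     cscale = scaleC, cadj = adj, cnorm = norm\<rparr>"

text \<open>Not assumed unital.\<close>

definition star_hom :: "'a cstar \<Rightarrow> 'b cstar \<Rightarrow> ('a \<Rightarrow> 'b) \<Rightarrow> bool" where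
  "star_hom X Y f \<longleftrightarrow> f \<in> carrier X \<rightarrow> carrier Y \<and>
     (\<forall>x\<in>carrier X. \<forall>y\<in>carrier X. f (x \<oplus>\<^bsub>X\<^esub> y) = f x \<oplus>\<^bsub>Y\<^esub> f y) \<and>
     (\<forall>x\<in>carrier X. \<forall>y\<in>carrier X. f (x \<otimes>\<^bsub>X\<^esub> y) = f x \<otimes>\<^bsub>Y\<^esub> f y) \<and>
     (\<forall>c. \<forall>x\<in>carrier X. f (cscale X c x) = cscale Y c (f x)) \<and>
     (\<forall>x\<in>carrier X. f (cadj X x) = cadj Y (f x))"

text \<open>The quotient by a closed two-sided ideal \<open>I\<close>: the quotient ring with the induced
  operations and the quotient norm.\<close>

definition quotient_map :: "'t::unital_cstar_algebra set \<Rightarrow> 't \<Rightarrow> 't set" where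
  "quotient_map I x = I +>\<^bsub>type_cstar\<^esub> x"

definition quotient_cstar :: "'t::unital_cstar_algebra set \<Rightarrow> 't set cstar" where
  "quotient_cstar I = (let R = type_cstar Quot I in
     \<lparr>carrier = carrier R, mult = mult R, one = one R, zero = zero R, add = add R,
      cscale = (\<lambda>c X. \<Union>x\<in>X. quotient_map I (c *\<^sub>C x)),
      cadj = (\<lambda>X. \<Union>x\<in>X. quotient_map I (adj x)),
      cnorm = (\<lambda>X. Inf (norm ` X))\<rparr>)"


section \<open>Transfer operators\<close>

definition nonneg :: "'a::unital_cstar_algebra \<Rightarrow> bool" where
  "nonneg a \<longleftrightarrow> (\<exists>b. a = adj b * b)"

definition transfer_operator ::
  "('a::unital_cstar_algebra \<Rightarrow> 'a) \<Rightarrow> ('a \<Rightarrow> 'a) \<Rightarrow> bool" where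
  "transfer_operator \<alpha> L \<longleftrightarrow>
     (\<forall>a b. L (a + b) = L a + L b) \<and> (\<forall>c a. L (c *\<^sub>C a) = c *\<^sub>C L a) \<and>
     continuous_on UNIV L \<and>
     (\<forall>a. nonneg a \<longrightarrow> nonneg (L a)) \<and>
     (\<forall>a b. L (\<alpha> a * b) = a * L b)"


section \<open>Hilbert bimodules\<close>

record ('a, 'm) hmodule =
  hcarrier :: "'m set"
  hzero :: 'm
  hadd :: "'m \<Rightarrow> 'm \<Rightarrow> 'm"
  hscale :: "complex \<Rightarrow> 'm \<Rightarrow> 'm"
  hright :: "'m \<Rightarrow> 'a \<Rightarrow> 'm"
  hinner :: "'m \<Rightarrow> 'm \<Rightarrow> 'a"
  hleft :: "'a \<Rightarrow> 'm \<Rightarrow> 'm"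

definition hnorm :: "('a::unital_cstar_algebra, 'm) hmodule \<Rightarrow> 'm \<Rightarrow> real" where
  "hnorm X x = sqrt (norm (hinner X x x))"

definition is_adjoint ::
  "('a::unital_cstar_algebra, 'm) hmodule \<Rightarrow> ('m \<Rightarrow> 'm) \<Rightarrow> ('m \<Rightarrow> 'm) \<Rightarrow> bool" where
  "is_adjoint X t s \<longleftrightarrow> s \<in> hcarrier X \<rightarrow>\<^sub>E hcarrier X \<and>
     (\<forall>x\<in>hcarrier X. \<forall>y\<in>hcarrier X. hinner X (t x) y = hinner X x (s y))"

text \<open>The C*-algebra of adjointable operators on \<open>X\<close>, with the operator norm. Boundedness of an
  adjointable operator on a Hilbert module is automatic; it is spelled out because the norm is a
  supremum in \<open>real\<close>.\<close>

definition adjointables :: "('a::unital_cstar_algebra, 'm) hmodule \<Rightarrow> ('m \<Rightarrow> 'm) cstar" where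
  "adjointables X =
     \<lparr>carrier = {t \<in> hcarrier X \<rightarrow>\<^sub>E hcarrier X.
        (\<exists>s. is_adjoint X t s) \<and> (\<exists>C. \<forall>x\<in>hcarrier X. hnorm X (t x) \<le> C * hnorm X x)},
      mult = (\<lambda>t s. \<lambda>x\<in>hcarrier X. t (s x)),
      one = (\<lambda>x\<in>hcarrier X. x),
      zero = (\<lambda>x\<in>hcarrier X. hzero X),
      add = (\<lambda>t s. \<lambda>x\<in>hcarrier X. hadd X (t x) (s x)),
      cscale = (\<lambda>c t. \<lambda>x\<in>hcarrier X. hscale X c (t x)),
      cadj = (\<lambda>t. THE s. is_adjoint X t s),
      cnorm = (\<lambda>t. Sup ((\<lambda>x. hnorm X (t x)) ` {x \<in> hcarrier X. hnorm X x \<le> 1}))\<rparr>"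

definition theta :: "('a::unital_cstar_algebra, 'm) hmodule \<Rightarrow> 'm \<Rightarrow> 'm \<Rightarrow> 'm \<Rightarrow> 'm" where
  "theta X x y = (\<lambda>z\<in>hcarrier X. hright X x (hinner X y z))"

inductive_set theta_span :: "('a::unital_cstar_algebra, 'm) hmodule \<Rightarrow> ('m \<Rightarrow> 'm) set"
  for X where
  zero: "\<zero>\<^bsub>adjointables X\<^esub> \<in> theta_span X"
| add: "\<lbrakk>t \<in> theta_span X; x \<in> hcarrier X; y \<in> hcarrier X\<rbrakk> \<Longrightarrow>
    cscale (adjointables X) c (theta X x y) \<oplus>\<^bsub>adjointables X\<^esub> t \<in> theta_span X"

definition compacts :: "('a::unital_cstar_algebra, 'm) hmodule \<Rightarrow> ('m \<Rightarrow> 'm) set" where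
  "compacts X = {t \<in> carrier (adjointables X).
     \<forall>e>0. \<exists>s\<in>theta_span X. cnorm (adjointables X) (t \<ominus>\<^bsub>adjointables X\<^esub> s) < e}"

definition left_op :: "('a::unital_cstar_algebra, 'm) hmodule \<Rightarrow> 'a \<Rightarrow> 'm \<Rightarrow> 'm" where
  "left_op X a = (\<lambda>x\<in>hcarrier X. hleft X a x)"

definition J_ideal :: "('a::unital_cstar_algebra, 'm) hmodule \<Rightarrow> 'a set" where
  "J_ideal X = {a. left_op X a \<in> compacts X}"

text \<open>The homomorphism \<open>(\<psi>, \<pi>)\<^sup>(\<^sup>1\<^sup>)\<close> on the compact operators; its defining property involves
  \<open>\<psi>\<close> only. Homomorphisms of C*-algebras are automatically contractive; contractivity is listed
  because it makes evident that the values on the \<open>theta X x y\<close> determine the map.\<close>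

definition induced_hom ::
  "('a::unital_cstar_algebra, 'm) hmodule \<Rightarrow> 'b cstar \<Rightarrow> ('m \<Rightarrow> 'b) \<Rightarrow> ('m \<Rightarrow> 'm) \<Rightarrow> 'b" where
  "induced_hom X B \<psi> = (THE F. F \<in> extensional (compacts X) \<and>
     star_hom ((adjointables X)\<lparr>carrier := compacts X\<rparr>) B F \<and>
     (\<forall>t\<in>compacts X. cnorm B (F t) \<le> cnorm (adjointables X) t) \<and>
     (\<forall>x\<in>hcarrier X. \<forall>y\<in>hcarrier X. F (theta X x y) = \<psi> x \<otimes>\<^bsub>B\<^esub> cadj B (\<psi> y)))"


section \<open>The bimodule of a transfer operator\<close>

text \<open>The completion of \<open>A\<^sub>L / N\<close> consists of the Cauchy sequences for the seminorm
  \<open>a \<mapsto> \<parallel>\<langle>a, a\<rangle>\<^sub>L\<parallel>\<^sup>1\<^sup>/\<^sup>2\<close> on \<open>A\<^sub>L\<close> modulo the relation that the difference tends to \<open>0\<close>.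
  On constant sequences this relation is congruence modulo \<open>N\<close>; \<open>bimod_q\<close> is the map \<open>q\<close>.\<close>

definition bimod_norm :: "('a::unital_cstar_algebra \<Rightarrow> 'a) \<Rightarrow> 'a \<Rightarrow> real" where
  "bimod_norm L a = sqrt (norm (L (adj a * a)))"

definition bimod_Cauchy :: "('a::unital_cstar_algebra \<Rightarrow> 'a) \<Rightarrow> (nat \<Rightarrow> 'a) \<Rightarrow> bool" where
  "bimod_Cauchy L x \<longleftrightarrow> (\<forall>e>0. \<exists>N. \<forall>m\<ge>N. \<forall>n\<ge>N. bimod_norm L (x m - x n) < e)"

definition bimod_rel :: "('a::unital_cstar_algebra \<Rightarrow> 'a) \<Rightarrow> ((nat \<Rightarrow> 'a) \<times> (nat \<Rightarrow> 'a)) set" where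
  "bimod_rel L = {(x, y). bimod_Cauchy L x \<and> bimod_Cauchy L y \<and> (\<lambda>n. bimod_norm L (x n - y n)) \<longlonglongrightarrow> 0}"

definition bimod_class :: "('a::unital_cstar_algebra \<Rightarrow> 'a) \<Rightarrow> (nat \<Rightarrow> 'a) \<Rightarrow> (nat \<Rightarrow> 'a) set" where
  "bimod_class L x = bimod_rel L `` {x}"

definition bimod_q :: "('a::unital_cstar_algebra \<Rightarrow> 'a) \<Rightarrow> 'a \<Rightarrow> (nat \<Rightarrow> 'a) set" where
  "bimod_q L a = bimod_class L (\<lambda>n. a)"

definition bimod_rep :: "(nat \<Rightarrow> 'a) set \<Rightarrow> nat \<Rightarrow> 'a" where
  "bimod_rep X = (SOME x. x \<in> X)"

definition bimod ::
  "('a::unital_cstar_algebra \<Rightarrow> 'a) \<Rightarrow> ('a \<Rightarrow> 'a) \<Rightarrow> ('a, (nat \<Rightarrow> 'a) set) hmodule" where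
  "bimod \<alpha> L =
     \<lparr>hcarrier = {x. bimod_Cauchy L x} // bimod_rel L,
      hzero = bimod_q L 0,
      hadd = (\<lambda>X Y. bimod_class L (\<lambda>n. bimod_rep X n + bimod_rep Y n)),
      hscale = (\<lambda>c X. bimod_class L (\<lambda>n. c *\<^sub>C bimod_rep X n)),
      hright = (\<lambda>X a. bimod_class L (\<lambda>n. bimod_rep X n * \<alpha> a)),
      hinner = (\<lambda>X Y. lim (\<lambda>n. L (adj (bimod_rep X n) * bimod_rep Y n))),
      hleft = (\<lambda>a X. bimod_class L (\<lambda>n. a * bimod_rep X n))\<rparr>"

text \<open>\<open>span\<close> is the real span; here and in \<open>redundancy\<close> below it is applied to sets that are
  closed under multiplication by complex scalars, for which it is the complex span.\<close>

definition range_ideal :: "('a::unital_cstar_algebra \<Rightarrow> 'a) \<Rightarrow> 'a set" where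
  "range_ideal \<alpha> = closure (span {a * \<alpha> b * c | a b c. True})"

definition K_alpha :: "('a::unital_cstar_algebra \<Rightarrow> 'a) \<Rightarrow> ('a \<Rightarrow> 'a) \<Rightarrow> 'a set" where
  "K_alpha \<alpha> L = range_ideal \<alpha> \<inter> J_ideal (bimod \<alpha> L)"


section \<open>Covariant representations\<close>

definition toeplitz_covariant_rep ::
  "('a::unital_cstar_algebra \<Rightarrow> 'a) \<Rightarrow> ('a \<Rightarrow> 'a) \<Rightarrow> 'b cstar \<Rightarrow> ('a \<Rightarrow> 'b) \<Rightarrow> 'b \<Rightarrow> bool" where
  "toeplitz_covariant_rep \<alpha> L B \<rho> V \<longleftrightarrow>
     unital_cstar B \<and> star_hom type_cstar B \<rho> \<and> \<rho> 1 = \<one>\<^bsub>B\<^esub> \<and> V \<in> carrier B \<and>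
     (\<forall>a. V \<otimes>\<^bsub>B\<^esub> \<rho> a = \<rho> (\<alpha> a) \<otimes>\<^bsub>B\<^esub> V) \<and>
     (\<forall>a. cadj B V \<otimes>\<^bsub>B\<^esub> \<rho> a \<otimes>\<^bsub>B\<^esub> V = \<rho> (L a))"

definition psi_map ::
  "('a::unital_cstar_algebra \<Rightarrow> 'a) \<Rightarrow> ('a \<Rightarrow> 'a) \<Rightarrow> 'b cstar \<Rightarrow> ('a \<Rightarrow> 'b) \<Rightarrow> 'b \<Rightarrow>
   (nat \<Rightarrow> 'a) set \<Rightarrow> 'b" where
  "psi_map \<alpha> L B \<rho> V = (let X = bimod \<alpha> L in
     THE \<psi>. \<psi> \<in> hcarrier X \<rightarrow>\<^sub>E carrier B \<and>
       (\<forall>x\<in>hcarrier X. \<forall>y\<in>hcarrier X. \<psi> (hadd X x y) = \<psi> x \<oplus>\<^bsub>B\<^esub> \<psi> y) \<and>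
       (\<forall>c. \<forall>x\<in>hcarrier X. \<psi> (hscale X c x) = cscale B c (\<psi> x)) \<and>
       (\<exists>C. \<forall>x\<in>hcarrier X. cnorm B (\<psi> x) \<le> C * hnorm X x) \<and>
       (\<forall>a. \<psi> (bimod_q L a) = \<rho> a \<otimes>\<^bsub>B\<^esub> V))"

definition covariant_rep ::
  "('a::unital_cstar_algebra \<Rightarrow> 'a) \<Rightarrow> ('a \<Rightarrow> 'a) \<Rightarrow> 'b cstar \<Rightarrow> ('a \<Rightarrow> 'b) \<Rightarrow> 'b \<Rightarrow> bool" where
  "covariant_rep \<alpha> L B \<rho> V \<longleftrightarrow> toeplitz_covariant_rep \<alpha> L B \<rho> V \<and>
     (\<forall>a\<in>K_alpha \<alpha> L.
        \<rho> a = induced_hom (bimod \<alpha> L) B (psi_map \<alpha> L B \<rho> V) (left_op (bimod \<alpha> L) a))"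


section \<open>The Toeplitz algebra and Exel's crossed product\<close>

text \<open>The triple \<open>('t, iA, S)\<close> is a universal unital C*-algebra generated by a Toeplitz-covariant
  representation. A HOL formula cannot quantify over types, so universality is stated for the
  C*-algebras carried by subsets of one type \<open>'b\<close>, which is a parameter. Injectivity of \<open>iA\<close>
  follows from universality for all C*-algebras (by means of the Fock representation), but not
  from universality for those on a given \<open>'b\<close>, and is therefore part of the definition.\<close>

definition toeplitz_algebra ::
  "'b itself \<Rightarrow> ('a::unital_cstar_algebra \<Rightarrow> 'a) \<Rightarrow> ('a \<Rightarrow> 'a) \<Rightarrow>
   ('a \<Rightarrow> 't::unital_cstar_algebra) \<Rightarrow> 't \<Rightarrow> bool" where
  "toeplitz_algebra _ \<alpha> L iA S \<longleftrightarrow>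
     toeplitz_covariant_rep \<alpha> L type_cstar iA S \<and>
     inj iA \<and>
     (\<forall>C. closed C \<and> range iA \<subseteq> C \<and> S \<in> C \<and>
        (\<forall>x\<in>C. \<forall>y\<in>C. x + y \<in> C \<and> x * y \<in> C) \<and> (\<forall>c. \<forall>x\<in>C. c *\<^sub>C x \<in> C) \<and> (\<forall>x\<in>C. adj x \<in> C)
        \<longrightarrow> C = UNIV) \<and>
     (\<forall>(B :: 'b cstar) \<rho> V. toeplitz_covariant_rep \<alpha> L B \<rho> V \<longrightarrow>
        (\<exists>\<theta>. star_hom type_cstar B \<theta> \<and> \<theta> \<circ> iA = \<rho> \<and> \<theta> S = V))"

definition redundancy ::
  "('a \<Rightarrow> 't::unital_cstar_algebra) \<Rightarrow> 't \<Rightarrow> 'a \<Rightarrow> 't \<Rightarrow> bool" where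
  "redundancy iA S a k \<longleftrightarrow>
     k \<in> closure (span {iA b * S * adj S * iA c | b c. True}) \<and>
     (\<forall>b. iA a * iA b * S = k * iA b * S)"

definition exel_ideal ::
  "('a::unital_cstar_algebra \<Rightarrow> 'a) \<Rightarrow> ('a \<Rightarrow> 't::unital_cstar_algebra) \<Rightarrow> 't \<Rightarrow> 't set" where
  "exel_ideal \<alpha> iA S = \<Inter>{I. ideal I type_cstar \<and> closed I \<and>
     {iA a - k | a k. a \<in> range_ideal \<alpha> \<and> redundancy iA S a k} \<subseteq> I}"

definition crossed_product ::
  "('a::unital_cstar_algebra \<Rightarrow> 'a) \<Rightarrow> ('a \<Rightarrow> 't::unital_cstar_algebra) \<Rightarrow> 't \<Rightarrow> 't set cstar" where
  "crossed_product \<alpha> iA S = quotient_cstar (exel_ideal \<alpha> iA S)"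

definition crossed_map ::
  "('a::unital_cstar_algebra \<Rightarrow> 'a) \<Rightarrow> ('a \<Rightarrow> 't::unital_cstar_algebra) \<Rightarrow> 't \<Rightarrow> 't \<Rightarrow> 't set" where
  "crossed_map \<alpha> iA S = quotient_map (exel_ideal \<alpha> iA S)"

end

theory Submission
  imports Defs
begin

text \<open>Since \<open>i\<^sub>A\<close> is injective, it is isometric, and \<open>q(a) \<mapsto> i\<^sub>A(a) S\<close> embeds \<open>M\<^sub>L\<close> isometrically
  into the Toeplitz algebra with image \<open>E\<close>, the closure of \<open>i\<^sub>A(A) S\<close>. Under this identification
  \<open>\<K>(M\<^sub>L)\<close> becomes the closed span \<open>K\<close> of \<open>E E\<^sup>*\<close> acting on \<open>E\<close> by left multiplication, so the
  redundancies \<open>(a, k)\<close> are exactly the pairs with \<open>\<phi>(a)\<close> compact and \<open>k = (\<psi>\<^sub>S, i\<^sub>A)\<^sup>(\<^sup>1\<^sup>)(\<phi>(a))\<close>.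
  For a homomorphism \<open>f\<close> on the Toeplitz algebra, \<open>(\<psi>, \<rho>)\<^sup>(\<^sup>1\<^sup>)\<close> is the restriction of \<open>f\<close> to \<open>K\<close>;
  hence \<open>(f \<circ> i\<^sub>A, f(S))\<close> is covariant if and only if \<open>f\<close> kills Exel's ideal.\<close>

section \<open>Square roots\<close>

text \<open>Three analytic facts carry the identification, all derived from the norm axioms without
  spectral theory. (1) For a self-adjoint contraction \<open>c\<close> there is a root of
  \<open>1 - c\<close> commuting with everything that commutes with \<open>c\<close>. It yields
  unitaries with given real part and stands in for positivity; hence homomorphisms are contractive
  and injective unital ones isometric. (2) The distance to a closed self-adjoint ideal satisfies the
  C*-identity, without which the crossed product would not be an admissible target of a covariant
  representation. (3) An element of \<open>K\<close> has the same norm as its action on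
  \<open>E\<close>. This makes the \<open>k\<close> in a redundancy unique and, together with (1),
  turns a homomorphism on the Toeplitz algebra into a contractive map on the compacts, as the
  definite description of the induced homomorphism demands. Exel's ideal is generated only as a
  closed two-sided ideal, so its invariance under the adjoint is traced back to
  redundancies.\<close>

lemma scaleC_zero_right [simp]: "c *\<^sub>C (0::'a::unital_cstar_algebra) = 0"
  using scaleC_add_right[of c 0 0] by simp

lemma scaleC_zero_left [simp]: "0 *\<^sub>C (x::'a::unital_cstar_algebra) = 0"
  using scaleC_add_left[of 0 0 x] by simp

lemma scaleC_one [simp]: "1 *\<^sub>C (x::'a::unital_cstar_algebra) = x"
  using scaleR_eq_scaleC[of 1 x] by simp

lemma scaleC_minus_one [simp]: "(- 1) *\<^sub>C (x::'a::unital_cstar_algebra) = - x"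
  using scaleR_eq_scaleC[of "-1" x] by simp

lemma scaleC_minus_right: "c *\<^sub>C (- x::'a::unital_cstar_algebra) = - (c *\<^sub>C x)"
  using scaleC_add_right[of c x "- x"] by (simp add: eq_neg_iff_add_eq_0 add.commute)

lemma scaleC_minus_left: "(- c) *\<^sub>C (x::'a::unital_cstar_algebra) = - (c *\<^sub>C x)"
  using scaleC_add_left[of c "- c" x] by (simp add: eq_neg_iff_add_eq_0 add.commute)

lemma scaleC_diff_right: "c *\<^sub>C (x - y::'a::unital_cstar_algebra) = c *\<^sub>C x - c *\<^sub>C y"
  using scaleC_add_right[of c x "- y"] by (simp add: scaleC_minus_right)

lemma adj_zero [simp]: "adj (0::'a::unital_cstar_algebra) = 0"
  using adj_add[of "0::'a" 0] by simp

lemma adj_minus: "adj (- x::'a::unital_cstar_algebra) = - adj x"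
  using adj_add[of x "- x"] by (simp add: eq_neg_iff_add_eq_0 add.commute)

lemma adj_diff: "adj (x - y::'a::unital_cstar_algebra) = adj x - adj y"
  using adj_add[of x "- y"] by (simp add: adj_minus)

lemma adj_one [simp]: "adj (1::'a::unital_cstar_algebra) = 1"
  by (metis adj_adj adj_mult mult_1_right)

lemma adj_scaleR: "adj (r *\<^sub>R x::'a::unital_cstar_algebra) = r *\<^sub>R adj x"
  by (simp add: scaleR_eq_scaleC adj_scaleC)

lemma norm_adj [simp]: "norm (adj (x::'a::unital_cstar_algebra)) = norm x"
proof -
  have le: "norm y \<le> norm (adj y)" for y :: 'a
  proof (cases "norm y = 0")
    case False
    have "norm y * norm y \<le> norm (adj y) * norm y"
      using norm_mult_ineq[of "adj y" y] by (simp add: norm_adj_mult_self power2_eq_square)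
    with False show ?thesis by (simp add: mult_le_cancel_right)
  qed simp
  show ?thesis using le[of x] le[of "adj x"] by (simp add: adj_adj)
qed

lemma norm_one_le: "norm (1::'a::unital_cstar_algebra) \<le> 1"
proof (cases "norm (1::'a) = 0")
  case False
  have "norm (1::'a) * norm (1::'a) = norm (1::'a)"
    using norm_adj_mult_self[of "1::'a"] by (simp add: power2_eq_square)
  with False show ?thesis by simp
qed simp

lemma norm_self_mult_adj: "norm (x * adj x) = (norm (x::'a::unital_cstar_algebra))\<^sup>2"
  using norm_adj_mult_self[of "adj x"] by (simp add: adj_adj)

lemma norm_square_selfadjoint:
  "adj h = h \<Longrightarrow> norm (h * h) = (norm (h::'a::unital_cstar_algebra))\<^sup>2"
  using norm_adj_mult_self[of h] by simp

lemma adj_mult_self_eq_0: "adj x * x = 0 \<Longrightarrow> x = (0::'a::unital_cstar_algebra)"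
  using norm_adj_mult_self[of x] by simp

lemma bounded_linear_adj: "bounded_linear (adj :: 'a::unital_cstar_algebra \<Rightarrow> 'a)"
  by (rule bounded_linear_intro[where K=1]) (auto simp: adj_add adj_scaleR)

lemmas tendsto_adj [tendsto_intros] = bounded_linear.tendsto[OF bounded_linear_adj]

lemma bounded_linear_scaleC: "bounded_linear (\<lambda>x::'a::unital_cstar_algebra. c *\<^sub>C x)"
  by (rule bounded_linear_intro[where K="cmod c"])
    (auto simp: scaleC_add_right norm_scaleC scaleR_eq_scaleC scaleC_scaleC mult.commute)

lemmas tendsto_scaleC [tendsto_intros] = bounded_linear.tendsto[OF bounded_linear_scaleC]

text \<open>The root is \<open>1 - l\<close>, where \<open>l\<close> is the limit of the iteration
  \<open>h (Suc n) = (c + h n * h n) / 2\<close>: its fixed point equation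
  \<open>2 l = c + l * l\<close> says \<open>(1 - l) * (1 - l) = 1 - c\<close>. Each
  \<open>h n\<close> is a polynomial in \<open>c\<close>, whence the commutation property. The bound
  on \<open>1 - b\<close> allows a second application, which extracts a root of \<open>b\<close>
  itself.\<close>

lemma sqrt_one_minus:
  fixes c :: "'a::unital_cstar_algebra"
  assumes sa: "adj c = c" and nc: "norm c \<le> 1"
  obtains b where "adj b = b" "b * b = 1 - c" "norm (1 - b) \<le> 1"
    "\<forall>x. x * c = c * x \<longrightarrow> x * b = b * x"
proof -
  define h where "h = rec_nat (0::'a) (\<lambda>_ h. (1/2) *\<^sub>R (c + h * h))"
  \<comment> \<open>The scalar iteration for \<open>c = 1\<close>, the worst case. It increases and
    stays below 1, so its increments are summable; they dominate those of \<open>h\<close>, which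
    gives convergence even when \<open>norm c = 1\<close>.\<close>
  define s where "s = rec_nat (0::real) (\<lambda>_ s. (1/2) * (1 + s * s))"
  have h0: "h 0 = 0" and hS: "h (Suc n) = (1/2) *\<^sub>R (c + h n * h n)" for n
    by (simp_all add: h_def)
  have s0: "s 0 = 0" and sS: "s (Suc n) = (1/2) * (1 + s n * s n)" for n
    by (simp_all add: s_def)
  have s01: "0 \<le> s n \<and> s n \<le> 1" for n
  proof (induction n)
    case (Suc n)
    then have "s n * s n \<le> 1" by (simp add: mult_le_one)
    then show ?case by (simp add: sS)
  qed (simp add: s0)
  have hs: "norm (h n) \<le> s n" for n
  proof (induction n)
    case (Suc n)
    have "norm (c + h n * h n) \<le> norm c + norm (h n) * norm (h n)"
      by (meson add_left_mono norm_mult_ineq norm_triangle_le)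
    also have "\<dots> \<le> 1 + s n * s n" using nc Suc s01[of n] by (intro add_mono mult_mono) auto
    finally show ?case by (simp add: hS sS)
  qed (simp add: h0 s0)
  have step: "norm (h (Suc n) - h n) \<le> s (Suc n) - s n" for n
  proof (induction n)
    case 0 show ?case using nc by (simp add: h0 s0 hS sS)
  next
    case (Suc n)
    \<comment> \<open>Difference of squares as
      \<open>x * x - y * y = x * (x - y) + (x - y) * y\<close>, valid without commutativity.\<close>
    have "h (Suc (Suc n)) - h (Suc n)
        = (1/2) *\<^sub>R (h (Suc n) * (h (Suc n) - h n) + (h (Suc n) - h n) * h n)"
      unfolding hS[of "Suc n"] by (subst hS[of n]) (simp add: algebra_simps flip: hS[of n])
    also have "norm \<dots> \<le> (1/2) * (norm (h (Suc n)) * norm (h (Suc n) - h n)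
        + norm (h (Suc n) - h n) * norm (h n))"
      unfolding norm_scaleR using norm_mult_ineq
      by (intro mult_mono norm_triangle_le add_mono) auto
    also have "\<dots> \<le> (1/2) * (s (Suc n) * (s (Suc n) - s n) + (s (Suc n) - s n) * s n)"
    proof -
      have "0 \<le> s (Suc n) - s n" using order_trans[OF norm_ge_zero Suc] .
      then show ?thesis using Suc hs[of n] hs[of "Suc n"] s01[of n] s01[of "Suc n"]
        by (intro mult_left_mono add_mono mult_mono) auto
    qed
    also have "\<dots> = s (Suc (Suc n)) - s (Suc n)"
      using sS[of "Suc n"] sS[of n] by (simp add: algebra_simps)
    finally show ?case .
  qed
  have "incseq s" using order_trans[OF norm_ge_zero step] by (intro incseq_SucI) (simp add: algebra_simps)
  then have "convergent s"
    using s01 by (meson convergent_def incseq_convergent)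
  then obtain l where "s \<longlonglongrightarrow> l" by (auto simp: convergent_def)
  then have "summable (\<lambda>n. s (Suc n) - s n)" by (rule telescope_summable)
  then have "summable (\<lambda>n. h (Suc n) - h n)"
    by (rule summable_comparison_test') (use step in auto)
  then have "(\<lambda>n. \<Sum>k<n. h (Suc k) - h k) \<longlonglongrightarrow> (\<Sum>k. h (Suc k) - h k)"
    by (rule summable_LIMSEQ)
  then obtain l where l: "h \<longlonglongrightarrow> l" by (auto simp: sum_lessThan_telescope h0)
  have "(\<lambda>n. h (Suc n)) \<longlonglongrightarrow> (1/2) *\<^sub>R (c + l * l)"
    unfolding hS by (intro tendsto_intros l)
  then have fix_l: "l = (1/2) *\<^sub>R (c + l * l)"
    using l LIMSEQ_Suc LIMSEQ_unique by blast
  have hadj: "adj (h n) = h n" for n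
    by (induction n) (auto simp: h0 hS adj_scaleR adj_add adj_mult sa)
  have ladj: "adj l = l"
    using tendsto_adj[OF l] l by (simp add: hadj LIMSEQ_unique)
  have comm: "x * l = l * x" if x: "x * c = c * x" for x
  proof -
    have "x * h n = h n * x" for n
    proof (induction n)
      case (Suc n)
      then have "x * (h n * h n) = (h n * h n) * x" by (metis mult.assoc)
      then show ?case using x by (simp add: hS algebra_simps)
    qed (simp add: h0)
    then have "(\<lambda>n. x * h n) \<longlonglongrightarrow> l * x"
      using tendsto_mult[OF l tendsto_const[of x]] by simp
    then show ?thesis using tendsto_mult[OF tendsto_const l] LIMSEQ_unique by blast
  qed
  have "norm l \<le> 1"
    using Lim_bounded[OF tendsto_norm[OF l], of 0 1] hs s01 order_trans by blast
  show ?thesis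
  proof (rule that[of "1 - l"])
    show "adj (1 - l) = 1 - l" by (simp add: adj_diff ladj)
    have "l + l = c + l * l" using fix_l
      by (metis (no_types, lifting) scaleR_half_double scaleR_right_distrib)
    then show "(1 - l) * (1 - l) = 1 - c" by (simp add: algebra_simps)
    show "norm (1 - (1 - l)) \<le> 1" using \<open>norm l \<le> 1\<close> by simp
    show "\<forall>x. x * c = c * x \<longrightarrow> x * (1 - l) = (1 - l) * x"
      using comm by (simp add: algebra_simps)
  qed
qed

section \<open>Self-adjoint elements as real parts of unitaries\<close>

lemma half_self_plus_adj: "(1/2) *\<^sub>R (u + v) = h \<Longrightarrow> norm u \<le> r \<Longrightarrow> norm v \<le> r \<Longrightarrow> norm h \<le> r"
  for u :: "'a::real_normed_vector"
  using norm_triangle_ineq[of u v] by auto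

text \<open>The mixed terms of \<open>adj u * u\<close> and \<open>u * adj u\<close> cancel because
  \<open>h\<close> and \<open>b\<close> commute. So \<open>u\<close> is a unitary with real part
  \<open>h\<close> as soon as \<open>h * h + b * b = 1\<close>.\<close>

lemma unitary_of_commuting_selfadjoint:
  fixes h b :: "'a::unital_cstar_algebra"
  assumes "adj h = h" "adj b = b" "h * b = b * h"
  defines "u \<equiv> h + \<i> *\<^sub>C b"
  shows "adj u = h - \<i> *\<^sub>C b" "adj u * u = h * h + b * b" "u * adj u = h * h + b * b"
    "(1/2) *\<^sub>R (u + adj u) = h"
proof -
  show *: "adj u = h - \<i> *\<^sub>C b"
    by (simp add: u_def adj_add adj_scaleC assms scaleC_minus_left)
  show "adj u * u = h * h + b * b" "u * adj u = h * h + b * b"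
    unfolding * unfolding u_def
    by (simp_all add: algebra_simps mult_scaleC_left mult_scaleC_right scaleC_scaleC
        scaleC_add_right scaleC_diff_right assms)
  show "(1/2) *\<^sub>R (u + adj u) = h" unfolding *
    using scaleR_half_double[of h] by (simp add: u_def)
qed

text \<open>Replaces an argument by order, with \<open>p\<close> as an explicit root of
  \<open>r - m * m\<close>: the square of the norm of \<open>m + \<i> *\<^sub>C p\<close> is at most
  \<open>r\<close>, and \<open>m\<close> is its real part. With \<open>r = 0\<close> it shows that
  commuting self-adjoint elements whose squares sum to 0 vanish.\<close>

lemma norm_le_of_square_sum:
  fixes m p :: "'a::unital_cstar_algebra"
  assumes "adj m = m" "adj p = p" "m * p = p * m" "m * m + p * p = r *\<^sub>R 1" "r \<ge> 0"
  shows "(norm m)\<^sup>2 \<le> r"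
proof -
  note u = unitary_of_commuting_selfadjoint[OF assms(1-3)]
  have "(norm (m + \<i> *\<^sub>C p))\<^sup>2 = norm (r *\<^sub>R (1::'a))"
    using norm_adj_mult_self[of "m + \<i> *\<^sub>C p"] by (simp add: u(2) assms(4))
  also have "\<dots> \<le> r" using norm_one_le assms(5) mult_left_le by (simp add: mult_left_le) 
  finally have "norm (m + \<i> *\<^sub>C p) \<le> sqrt r" by (simp add: real_le_rsqrt)
  then have "norm m \<le> sqrt r" using half_self_plus_adj[OF u(4)] by simp
  then show ?thesis using assms(5) by (metis norm_ge_zero power_mono real_sqrt_pow2)
qed

lemma selfadjoint_contraction_unitary:
  fixes h :: "'a::unital_cstar_algebra"
  assumes "adj h = h" "norm h \<le> 1"
  obtains u where "adj u * u = 1" "u * adj u = 1" "(1/2) *\<^sub>R (u + adj u) = h"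
proof -
  have "norm (h * h) \<le> 1" using assms by (simp add: norm_square_selfadjoint power_le_one)
  moreover have "adj (h * h) = h * h" by (simp add: adj_mult assms)
  ultimately obtain b where b: "adj b = b" "b * b = 1 - h * h" "norm (1 - b) \<le> 1"
      "\<forall>x. x * (h * h) = (h * h) * x \<longrightarrow> x * b = b * x"
    by (metis sqrt_one_minus)
  have "h * b = b * h" using b(4) by (simp add: mult.assoc)
  note u = unitary_of_commuting_selfadjoint[OF assms(1) b(1) this]
  show ?thesis by (rule that[OF _ _ u(4)]) (simp_all only: u(2,3) b(2), simp_all)
qed

text \<open>The triangle inequality only gives 2. The root \<open>b\<close> of
  \<open>1 - h * h\<close> satisfies \<open>b * b + h * h = 1\<close>, which forces
  \<open>norm b \<le> 1\<close>.\<close>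

lemma norm_one_minus_square:
  fixes h :: "'a::unital_cstar_algebra"
  assumes "adj h = h" "norm h \<le> 1"
  shows "norm (1 - h * h) \<le> 1"
proof -
  have "norm (h * h) \<le> 1" using assms by (simp add: norm_square_selfadjoint power_le_one)
  moreover have "adj (h * h) = h * h" by (simp add: adj_mult assms)
  ultimately obtain b where b: "adj b = b" "b * b = 1 - h * h" "norm (1 - b) \<le> 1"
      "\<forall>x. x * (h * h) = (h * h) * x \<longrightarrow> x * b = b * x"
    by (metis sqrt_one_minus)
  have "h * b = b * h" using b(4) by (simp add: mult.assoc)
  from norm_le_of_square_sum[OF b(1) assms(1) this[symmetric], of 1]
  have "(norm b)\<^sup>2 \<le> 1" by (simp add: b(2))
  then show ?thesis using norm_square_selfadjoint[OF b(1)] by (simp add: b(2))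
qed

section \<open>Norms under homomorphisms\<close>

lemma type_cstar_simps [simp]:
  "carrier type_cstar = UNIV" "mult type_cstar = (*)" "one type_cstar = 1"
  "zero type_cstar = 0" "add type_cstar = (+)" "cscale type_cstar = scaleC"
  "cadj type_cstar = adj" "cnorm type_cstar = norm"
  by (simp_all add: type_cstar_def)

lemma ring_type_cstar: "ring (type_cstar :: 'a::unital_cstar_algebra cstar)"
proof (rule ringI)
  show "abelian_group (type_cstar :: 'a cstar)"
  proof (rule abelian_groupI)
    show "\<exists>y\<in>carrier type_cstar. y \<oplus>\<^bsub>type_cstar\<^esub> x = \<zero>\<^bsub>type_cstar\<^esub>" for x :: 'a
      by (rule bexI[of _ "- x"]) simp_all
  qed (simp_all add: ac_simps)
  show "monoid (type_cstar :: 'a cstar)"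
    by (rule monoidI) (simp_all add: mult.assoc)
qed (simp_all add: algebra_simps)

lemma a_minus_type_cstar [simp]: "x \<ominus>\<^bsub>type_cstar\<^esub> y = x - (y::'a::unital_cstar_algebra)"
proof -
  interpret ring "type_cstar :: 'a cstar" by (rule ring_type_cstar)
  have "\<ominus>\<^bsub>type_cstar\<^esub> y = - y" using l_neg[of y] by (simp add: eq_neg_iff_add_eq_0)
  then show ?thesis by (simp add: a_minus_def)
qed

lemma unital_cstar_type: "unital_cstar (type_cstar :: 'a::unital_cstar_algebra cstar)"
proof (intro unital_cstar.intro ring_type_cstar unital_cstar_axioms.intro)
  fix f :: "nat \<Rightarrow> 'a"
  assume "\<forall>e>0. \<exists>N. \<forall>m\<ge>N. \<forall>n\<ge>N. cnorm type_cstar (f m \<ominus>\<^bsub>type_cstar\<^esub> f n) < e"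
  then have "Cauchy f" by (auto simp: Cauchy_def dist_norm)
  then obtain l where "f \<longlonglongrightarrow> l" by (auto simp: Cauchy_convergent_iff convergent_def)
  then show "\<exists>l\<in>carrier type_cstar. (\<lambda>n. cnorm type_cstar (f n \<ominus>\<^bsub>type_cstar\<^esub> l)) \<longlonglongrightarrow> 0"
    by (auto simp: tendsto_norm_zero_iff LIM_zero_iff)
qed (simp_all add: scaleC_add_right scaleC_add_left scaleC_scaleC mult_scaleC_left
    mult_scaleC_right norm_scaleC adj_adj adj_add adj_scaleC adj_mult norm_adj_mult_self
    norm_triangle_ineq norm_mult_ineq)

lemma star_hom_typeD:
  assumes "star_hom type_cstar B f"
  shows "f x \<in> carrier B" "f (x + y) = f x \<oplus>\<^bsub>B\<^esub> f y" "f (x * y) = f x \<otimes>\<^bsub>B\<^esub> f y"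
    "f (c *\<^sub>C x) = cscale B c (f x)" "f (adj x) = cadj B (f x)"
  using assms by (auto simp: star_hom_def)

context unital_cstar
begin

lemma cscale_zero: "x \<in> carrier B \<Longrightarrow> cscale B 0 x = \<zero>"
  using cscale_add_left[of x 0 0] cscale_closed[of x 0] by simp

lemma cscale_minus_one: "x \<in> carrier B \<Longrightarrow> cscale B (- 1) x = \<ominus> x"
  using cscale_add_left[of x "- 1" 1] cscale_closed[of x "- 1"]
    minus_equality[of "cscale B (- 1) x" x]
  by (simp add: cscale_one cscale_zero)

lemma cnorm_zero: "cnorm B \<zero> = 0"
  by (simp add: cnorm_eq_0_iff)

lemma cnorm_uminus: "x \<in> carrier B \<Longrightarrow> cnorm B (\<ominus> x) = cnorm B x"
  using cnorm_cscale[of x "- 1"] by (simp add: cscale_minus_one)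

lemma cnorm_nonneg: "x \<in> carrier B \<Longrightarrow> 0 \<le> cnorm B x"
  using cnorm_triangle[of x "\<ominus> x"] by (simp add: cnorm_uminus r_neg cnorm_zero)

lemma cnorm_diff_triangle:
  "x \<in> carrier B \<Longrightarrow> y \<in> carrier B \<Longrightarrow> z \<in> carrier B \<Longrightarrow>
    cnorm B (x \<ominus> z) \<le> cnorm B (x \<ominus> y) + cnorm B (y \<ominus> z)"
proof -
  assume c: "x \<in> carrier B" "y \<in> carrier B" "z \<in> carrier B"
  then have "x \<ominus> z = (x \<ominus> y) \<oplus> (y \<ominus> z)" by algebra
  then show ?thesis using c cnorm_triangle[of "x \<ominus> y" "y \<ominus> z"] by simp
qed

lemma eq_if_cnorm_diff_small:
  assumes "x \<in> carrier B" "y \<in> carrier B" "\<And>e. e > 0 \<Longrightarrow> cnorm B (x \<ominus> y) \<le> e"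
  shows "x = y"
proof -
  have "cnorm B (x \<ominus> y) = 0"
    using field_le_epsilon[of "cnorm B (x \<ominus> y)" 0] cnorm_nonneg[of "x \<ominus> y"] assms by simp
  then have "x \<ominus> y = \<zero>" using assms(1,2) by (simp add: cnorm_eq_0_iff)
  then show ?thesis using assms(1,2) by (metis a_minus_def add.inv_closed minus_equality minus_minus)
qed

text \<open>Meant for the image of the unit, which is a projection when the homomorphism is not
  assumed unital.\<close>

lemma cnorm_projection:
  assumes "p \<in> carrier B" "cadj B p \<otimes> p = p"
  shows "cnorm B p \<le> 1"
proof (cases "cnorm B p = 0")
  case False
  have "cnorm B p * cnorm B p = cnorm B p"
    using cnorm_cadj_mult_self[OF assms(1)] assms(2) by (simp add: power2_eq_square)
  with False show ?thesis by simp
qed simp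

lemma star_hom_diff:
  assumes "star_hom type_cstar B f"
  shows "f (x - y) = f x \<ominus> f y"
proof -
  note [simp] = star_hom_typeD[OF assms]
  have "f x = f (x - y) \<oplus> f y" by (simp flip: star_hom_typeD(2)[OF assms])
  then show ?thesis by (metis add.inv_solve_right' star_hom_typeD(1)[OF assms] a_minus_def)
qed

lemma star_hom_zero: "star_hom type_cstar B f \<Longrightarrow> f 0 = \<zero>"
  using star_hom_diff[of f 0 0] by (simp add: star_hom_typeD(1) a_minus_def r_neg)

text \<open>A self-adjoint contraction is the real part of a unitary, and a homomorphism maps unitaries
  to partial isometries.\<close>

lemma star_hom_contractive:
  assumes f: "star_hom type_cstar B f"
  shows "cnorm B (f x) \<le> norm x"
proof -
  note D = star_hom_typeD[OF f]
  have p: "cnorm B (f 1) \<le> 1"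
    by (rule cnorm_projection) (simp_all add: D flip: D(5) D(3))
  have iso: "cnorm B (f u) \<le> 1" if "adj u * u = 1" for u
  proof -
    have "cadj B (f u) \<otimes> f u = f 1" by (simp add: that flip: D(5) D(3))
    then have "(cnorm B (f u))\<^sup>2 \<le> 1" using cnorm_cadj_mult_self[of "f u"] p by (simp add: D)
    then show ?thesis by (simp add: cnorm_nonneg D abs_square_le_1)
  qed
  have sa1: "cnorm B (f h) \<le> 1" if h: "adj h = h" "norm h \<le> 1" for h
  proof -
    obtain u where u: "adj u * u = 1" "u * adj u = 1" "(1/2) *\<^sub>R (u + adj u) = h"
      using selfadjoint_contraction_unitary[OF h] by metis
    have "cnorm B (f u \<oplus> f (adj u)) \<le> 1 + 1"
      using cnorm_triangle[of "f u" "f (adj u)"] iso[of u] iso[of "adj u"] u by (simp add: D(1) adj_adj)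
    moreover have "f h = cscale B (1/2) (f u \<oplus> f (adj u))"
      by (simp add: scaleR_eq_scaleC flip: u(3) D(2) D(4))
    ultimately show ?thesis by (simp add: cnorm_cscale D cadj_closed)
  qed
  have sa: "cnorm B (f h) \<le> norm h" if h: "adj h = h" for h
  proof (cases "h = 0")
    case True
    then show ?thesis using star_hom_zero[OF f] cnorm_eq_0_iff[of \<zero>] by simp
  next
    case False
    have "cnorm B (f (complex_of_real (1 / norm h) *\<^sub>C h)) \<le> 1"
      by (rule sa1) (use False h in \<open>simp_all add: adj_scaleC norm_scaleC norm_divide\<close>)
    then have "cmod (complex_of_real (1 / norm h)) * cnorm B (f h) \<le> 1"
      by (simp only: D cnorm_cscale)
    then show ?thesis using False by (simp add: norm_divide field_simps)
  qed
  have "(cnorm B (f x))\<^sup>2 = cnorm B (f (adj x * x))"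
    by (simp add: D cnorm_cadj_mult_self)
  also have "\<dots> \<le> (norm x)\<^sup>2" using sa[of "adj x * x"] by (simp add: adj_mult adj_adj norm_adj_mult_self)
  finally show ?thesis by (rule power2_le_imp_le) simp
qed

end

lemmas star_hom_type_contractive = unital_cstar.star_hom_contractive[OF unital_cstar_type, simplified]

lemma commute_mult: "x * z = z * x \<Longrightarrow> y * z = z * y \<Longrightarrow> (x * y) * z = z * (x * y)"
  for x :: "'a::semigroup_mult"
  by (metis mult.assoc)

text \<open>With \<open>g = (m\<^sup>2 - r)/2\<close> and \<open>p = \<bar>g\<bar>\<close>, the element \<open>p + g\<close> is twice the positive part of \<open>g\<close>.
  Its image \<open>e\<close> vanishes because \<open>e\<^sup>2 = e (f m\<^sup>2 - r)\<close> and \<open>f m\<^sup>2 \<le> r\<close>; here and below,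
  positivity is only used through explicit square roots.\<close>

lemma injective_star_hom_norm_le:
  fixes f :: "'a::unital_cstar_algebra \<Rightarrow> 'b::unital_cstar_algebra"
  assumes f: "star_hom type_cstar type_cstar f" and f1: "f 1 = 1" and inj: "inj f"
    and m: "adj m = m" "norm m \<le> 1"
  shows "norm m \<le> norm (f m)"
proof -
  note D = star_hom_typeD[OF f, simplified]
  have f0: "f 0 = 0" using D(2)[of 0 0] by simp
  have fR: "f (r *\<^sub>R x) = r *\<^sub>R f x" for r x by (simp add: scaleR_eq_scaleC D)
  have fdiff: "f (x - y) = f x - f y" for x y using D(2)[of "x - y" y] by simp
  \<comment> \<open>The claim is that the square of \<open>norm m\<close> is at most
    \<open>r\<close>. It will follow from a root of \<open>r - m * m\<close>, which becomes
    available once \<open>g\<close> is known to have no positive part.\<close>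
  define r where "r = (norm (f m))\<^sup>2"
  have r: "0 \<le> r" "r \<le> 1"
    using star_hom_type_contractive[OF f, of m] m(2) by (auto simp: r_def power_le_one)
  define g where "g = (1/2) *\<^sub>R (m * m - r *\<^sub>R 1)"
  have gsa: "adj g = g" by (simp add: g_def adj_scaleR adj_diff adj_mult m)
  have "norm (m * m - r *\<^sub>R 1) \<le> norm m * norm m + r * norm (1::'a)"
    using norm_triangle_ineq4[of "m * m" "r *\<^sub>R 1"] norm_mult_ineq[of m m] r by simp
  also have "\<dots> \<le> 1 + 1"
    using m(2) r norm_one_le[where 'a='a] by (intro add_mono mult_le_one) auto
  finally have ng: "norm g \<le> 1" by (simp add: g_def)
  \<comment> \<open>\<open>p\<close> and \<open>s\<close> are roots of \<open>g * g\<close> and of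
    \<open>p\<close>; both radicands are written as \<open>1 - c\<close> with \<open>c\<close> a
    self-adjoint contraction to fit \<open>sqrt_one_minus\<close>.\<close>
  have "adj (1 - g * g) = 1 - g * g" by (simp add: adj_diff adj_mult gsa)
  then obtain p where p: "adj p = p" "p * p = 1 - (1 - g * g)" "norm (1 - p) \<le> 1"
      "\<forall>x. x * (1 - g * g) = (1 - g * g) * x \<longrightarrow> x * p = p * x"
    by (rule sqrt_one_minus[OF _ norm_one_minus_square[OF gsa ng]])
  have "adj (1 - p) = 1 - p" by (simp add: adj_diff p)
  then obtain s where s: "adj s = s" "s * s = 1 - (1 - p)"
      "\<forall>x. x * (1 - p) = (1 - p) * x \<longrightarrow> x * s = s * x"
    by (rule sqrt_one_minus[OF _ p(3)])
  have pp: "p * p = g * g" and s2: "s * s = p" using p(2) s(2) by simp_all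
  define k where "k = f m * f m"
  have fm: "adj (f m) = f m" using D(5)[of m] by (simp add: m)
  have "norm k = r" by (simp add: k_def r_def norm_square_selfadjoint fm)
  \<comment> \<open>\<open>w\<close> is to be a root of \<open>r - k\<close>, that is of
    \<open>- 2 * f g\<close>, hence \<open>c = 1 - r + k\<close>; its norm is at most
    \<open>(1 - r) + r\<close>.\<close>
  then have c1: "norm ((1 - r) *\<^sub>R 1 + k) \<le> 1"
    using norm_triangle_ineq[of "(1 - r) *\<^sub>R 1" k] norm_one_le[where 'a='b] r
      mult_left_mono[of "norm (1::'b)" 1 "1 - r"] by simp
  have "adj ((1 - r) *\<^sub>R 1 + k) = (1 - r) *\<^sub>R 1 + k"
    by (simp add: adj_add adj_scaleR k_def adj_mult fm)
  then obtain w where w: "adj w = w" "w * w = 1 - ((1 - r) *\<^sub>R 1 + k)" "norm (1 - w) \<le> 1"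
      "\<forall>x. x * ((1 - r) *\<^sub>R 1 + k) = ((1 - r) *\<^sub>R 1 + k) * x \<longrightarrow> x * w = w * x"
    by (rule sqrt_one_minus[OF _ c1])
  have ww: "(1/2) *\<^sub>R (w * w) = - f g"
    by (simp add: w(2) g_def fR fdiff D f1 k_def algebra_simps)
  have mg: "m * g = g * m" by (simp add: g_def algebra_simps)
  have mp: "m * p = p * m"
    by (rule p(4)[rule_format]) (simp add: right_diff_distrib left_diff_distrib commute_mult[OF mg[symmetric] mg[symmetric]])
  have gp: "g * p = p * g" by (rule p(4)[rule_format]) (simp add: algebra_simps)
  have ms: "m * s = s * m" by (rule s(3)[rule_format]) (simp add: right_diff_distrib left_diff_distrib mp)
  have gs: "g * s = s * g" by (rule s(3)[rule_format]) (simp add: right_diff_distrib left_diff_distrib gp)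
  have ps: "p * s = s * p" by (rule s(3)[rule_format]) (simp add: right_diff_distrib left_diff_distrib)
  have cw: "f x * w = w * f x" if "x * m = m * x" for x
  proof (rule w(4)[rule_format])
    have "f m * f x = f x * f m" using that by (metis D(3))
    from commute_mult[OF this this] show "f x * ((1 - r) *\<^sub>R 1 + k) = ((1 - r) *\<^sub>R 1 + k) * f x"
      by (simp add: k_def distrib_left distrib_right)
  qed
  define e where "e = f (p + g)"
  have esa: "adj e = e" by (simp add: e_def adj_add p gsa flip: D(5))
  have ew: "e * w = w * e" unfolding e_def
    by (rule cw) (simp add: distrib_left distrib_right mp mg)
  have sw: "f s * w = w * f s" by (rule cw) (rule ms[symmetric])
  have es: "e * f s = f s * e"
    unfolding e_def by (simp add: distrib_left distrib_right ps gs flip: D(3))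
  have "(p + g) * (p - g) = 0" by (simp add: algebra_simps gp pp)
  then have ez: "e * (f p - f g) = 0" by (simp add: e_def f0 flip: D(3) fdiff)
  \<comment> \<open>\<open>X\<close> and \<open>Y\<close> are commuting self-adjoint roots of
    \<open>e * e * f p\<close> and \<open>- e * e * f g\<close>. These sum to
    \<open>e * e * (f p - f g)\<close>, which is 0 because \<open>(p + g) * (p - g) = 0\<close>; so
    both \<open>X\<close> and \<open>Y\<close> vanish.\<close>
  define X where "X = e * f s"
  define Y where "Y = sqrt (1/2) *\<^sub>R (e * w)"
  have Xsa: "adj X = X" by (simp add: X_def adj_mult esa es s(1) flip: D(5))
  have Ysa: "adj Y = Y" by (simp add: Y_def adj_mult adj_scaleR esa ew w(1))
  have XY: "X * Y = Y * X"
  proof -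
    have "X * e = e * X" unfolding X_def by (rule commute_mult) (simp_all add: es)
    moreover have "X * w = w * X" unfolding X_def by (rule commute_mult) (simp_all add: ew sw)
    ultimately have "(e * w) * X = X * (e * w)" by (intro commute_mult) simp_all
    then show ?thesis by (simp add: Y_def)
  qed
  have "X * X = e * (e * f p)"
    by (simp add: X_def D s2[symmetric]) (metis es mult.assoc)
  moreover have "Y * Y = e * (e * ((1/2) *\<^sub>R (w * w)))"
    by (simp add: Y_def) (metis ew mult.assoc)
  ultimately have sum0: "X * X + Y * Y = 0 *\<^sub>R 1"
    using ez by (simp add: ww algebra_simps)
  have "(norm X)\<^sup>2 \<le> 0" by (rule norm_le_of_square_sum[OF Xsa Ysa XY sum0]) simp
  then have X0: "X = 0" by simp
  have "(norm Y)\<^sup>2 \<le> 0"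
    by (rule norm_le_of_square_sum[OF Ysa Xsa XY[symmetric]]) (use sum0 in \<open>simp_all add: add.commute\<close>)
  then have Y0: "e * w = 0" by (simp add: Y_def)
  have "e * e = e * f p + e * f g" by (simp add: e_def D distrib_left)
  also have "e * f p = X * f s" by (simp add: X_def D s2[symmetric] mult.assoc)
  also have "e * f g = - (1/2) *\<^sub>R (e * w * w)"
    using arg_cong[OF minus_equation_iff[THEN iffD1, OF ww[symmetric]], of "\<lambda>z. e * z"]
    by (simp add: mult.assoc)
  finally have "adj e * e = 0" by (simp add: X0 Y0 esa)
  then have "f (p + g) = f 0" using adj_mult_self_eq_0 by (simp add: e_def f0)
  then have pg: "p + g = 0" using inj by (simp add: inj_eq)
  \<comment> \<open>As \<open>p = - g\<close>, the element \<open>sqrt 2 *\<^sub>R s\<close> squares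
    to \<open>2 p = r - m * m\<close>.\<close>
  have "(norm m)\<^sup>2 \<le> r"
  proof (rule norm_le_of_square_sum[OF m(1) _ _ _ r(1)])
    show "adj (sqrt 2 *\<^sub>R s) = sqrt 2 *\<^sub>R s" by (simp add: adj_scaleR s)
    show "m * (sqrt 2 *\<^sub>R s) = (sqrt 2 *\<^sub>R s) * m" by (simp add: ms)
    have "p = - g" using pg by (simp add: eq_neg_iff_add_eq_0)
    then show "m * m + (sqrt 2 *\<^sub>R s) * (sqrt 2 *\<^sub>R s) = r *\<^sub>R 1"
      by (simp add: s2) (simp add: g_def algebra_simps)
  qed
  then show ?thesis unfolding r_def by (rule power2_le_imp_le) simp
qed

lemma injective_star_hom_isometric:
  fixes f :: "'a::unital_cstar_algebra \<Rightarrow> 'b::unital_cstar_algebra"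
  assumes f: "star_hom type_cstar type_cstar f" and f1: "f 1 = 1" and inj: "inj f"
  shows "norm (f x) = norm x"
proof -
  note D = star_hom_typeD[OF f, simplified]
  have sa: "norm h \<le> norm (f h)" if h: "adj h = h" for h
  proof (cases "h = 0")
    case False
    define c where "c = 1 / norm h"
    have "norm (c *\<^sub>R h) \<le> norm (f (c *\<^sub>R h))"
      by (rule injective_star_hom_norm_le[OF assms]) (use False in \<open>simp_all add: adj_scaleR h c_def\<close>)
    then show ?thesis using False
      by (simp add: scaleR_eq_scaleC D norm_scaleC c_def norm_divide divide_right_mono field_simps)
  qed simp
  have "(norm x)\<^sup>2 \<le> norm (f (adj x * x))"
    using sa[of "adj x * x"] by (simp add: adj_mult adj_adj norm_adj_mult_self)
  also have "\<dots> = (norm (f x))\<^sup>2" by (simp add: D norm_adj_mult_self)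
  finally have "norm x \<le> norm (f x)" by (rule power2_le_imp_le) simp
  then show ?thesis using star_hom_type_contractive[OF f, of x] by simp
qed

section \<open>Quotients\<close>

lemma norm_contraction_mult:
  fixes a :: "'a::real_normed_algebra"
  assumes "norm a \<le> 1"
  shows "norm (a * v) \<le> norm v" "norm (v * a) \<le> norm v"
  using assms norm_mult_ineq[of a v] norm_mult_ineq[of v a]
    mult_left_le_one_le[of "norm v" "norm a"] mult_right_le_one_le[of "norm v" "norm a"] by auto

text \<open>The resolvent \<open>w = (1 + n h\<^sup>2)\<^sup>-\<^sup>1\<close>, as a Banach fixed point of
  \<open>w = (1 + n (1 - h\<^sup>2) w) / (n + 1)\<close>. The elements \<open>1 - w\<close> serve as approximate unit of a closed
  ideal containing \<open>h\<close>.\<close>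

lemma square_resolvent:
  fixes h :: "'a::unital_cstar_algebra" and n :: real
  assumes h: "adj h = h" "norm h \<le> 1" and n: "n > 0"
  obtains w where "adj w = w" "norm w \<le> 1" "1 - w = n *\<^sub>R (h * h * w)" "n * (norm (h * w))\<^sup>2 \<le> 2"
proof -
  define F where "F w = (1 / (n + 1)) *\<^sub>R (1 + n *\<^sub>R ((1 - h * h) * w))" for w
  have n1: "norm ((1 - h * h) * v) \<le> norm v" for v
    by (rule norm_contraction_mult[OF norm_one_minus_square[OF h]])
  \<comment> \<open>The contraction constant is \<open>n / (n + 1)\<close> because
    \<open>norm (1 - h * h) \<le> 1\<close>.\<close>
  have "\<exists>!w. F w = w"
  proof (rule banach_fix_type)
    show "0 \<le> n / (n + 1)" "n / (n + 1) < 1" using n by (simp_all add: field_simps)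
    show "\<forall>v w. dist (F v) (F w) \<le> n / (n + 1) * dist v w"
    proof (intro allI)
      fix v w
      have "F v - F w = (n / (n + 1)) *\<^sub>R ((1 - h * h) * (v - w))"
        by (simp add: F_def scaleR_diff_right right_diff_distrib scaleR_add_right)
      then show "dist (F v) (F w) \<le> n / (n + 1) * dist v w"
        using n1[of "v - w"] n by (simp add: dist_norm divide_right_mono)
    qed
  qed
  then obtain w where "F w = w" by blast
  moreover have "(n + 1) *\<^sub>R F w = 1 + n *\<^sub>R ((1 - h * h) * w)"
    using n by (simp add: F_def)
  ultimately have "(n + 1) *\<^sub>R w = 1 + n *\<^sub>R ((1 - h * h) * w)" by simp
  then have w: "1 - w = n *\<^sub>R (h * h * w)" and nw: "(n + 1) *\<^sub>R w = 1 + n *\<^sub>R ((1 - h * h) * w)"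
    by (simp_all add: algebra_simps)
  have "(n + 1) * norm w \<le> 1 + n * norm w"
  proof -
    have "(n + 1) * norm w = norm (1 + n *\<^sub>R ((1 - h * h) * w))"
      using n by (simp flip: nw)
    also have "\<dots> \<le> norm (1::'a) + n * norm ((1 - h * h) * w)"
      using norm_triangle_ineq[of 1 "n *\<^sub>R ((1 - h * h) * w)"] n by simp
    also have "\<dots> \<le> 1 + n * norm w"
      using n n1[of w] norm_one_le by (intro add_mono mult_left_mono) auto
    finally show ?thesis .
  qed
  then have nw1: "norm w \<le> 1" by (simp add: algebra_simps)
  have w1: "w + n *\<^sub>R (h * h * w) = 1" using w by (simp add: algebra_simps)
  \<comment> \<open>\<open>w\<close> is a right inverse of \<open>1 + n *\<^sub>R (h * h)\<close>
    and \<open>adj w\<close> a left inverse, so they coincide.\<close>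
  have "adj w + n *\<^sub>R (adj w * (h * h)) = 1"
    using arg_cong[OF w1, of adj] by (simp add: adj_add adj_scaleR adj_mult h mult.assoc)
  then have "w = (adj w + n *\<^sub>R (adj w * (h * h))) * w" by simp
  also have "\<dots> = adj w * (w + n *\<^sub>R (h * h * w))" by (simp add: algebra_simps)
  finally have wsa: "adj w = w" by (simp add: w1)
  have "(norm (h * w))\<^sup>2 = norm (w * (h * h * w))"
    using norm_adj_mult_self[of "h * w"] by (simp add: adj_mult h wsa mult.assoc)
  also have "\<dots> \<le> norm (h * h * w)"
    by (rule norm_contraction_mult[OF nw1])
  finally have "n * (norm (h * w))\<^sup>2 \<le> n * norm (h * h * w)" using n by simp
  also have "\<dots> = norm (1 - w)" using n by (simp add: w)
  also have "\<dots> \<le> 2"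
    using norm_triangle_ineq4[of 1 w] norm_one_le[where 'a='a] nw1 by linarith
  finally show ?thesis using that wsa nw1 w by blast
qed

section \<open>The norm of a quotient by a closed self-adjoint ideal\<close>

locale closed_star_ideal = ideal I type_cstar for I :: "'t::unital_cstar_algebra set" +
  assumes closed: "closed I" and adj_mem: "x \<in> I \<Longrightarrow> adj x \<in> I"
begin

lemma zero_mem: "0 \<in> I" using additive_subgroup.zero_closed[OF is_additive_subgroup] by simp

lemma add_mem: "x \<in> I \<Longrightarrow> y \<in> I \<Longrightarrow> x + y \<in> I" using additive_subgroup.a_closed[OF is_additive_subgroup, of x y] by simp

lemma mult_left_mem: "x \<in> I \<Longrightarrow> y * x \<in> I" using I_l_closed[of x y] by simp

lemma mult_right_mem: "x \<in> I \<Longrightarrow> x * y \<in> I" using I_r_closed[of x y] by simp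

lemma scaleC_mem: "x \<in> I \<Longrightarrow> c *\<^sub>C x \<in> I"
  using mult_left_mem[of x "c *\<^sub>C 1"] by (simp add: mult_scaleC_left)

lemma scaleR_mem: "x \<in> I \<Longrightarrow> r *\<^sub>R x \<in> I" by (simp add: scaleR_eq_scaleC scaleC_mem)

lemma minus_mem: "x \<in> I \<Longrightarrow> - x \<in> I" using scaleC_mem[of x "- 1"] by simp

lemma diff_commute_mem: "x - y \<in> I \<longleftrightarrow> y - x \<in> I" using minus_mem[of "x - y"] minus_mem[of "y - x"] by auto

lemma quotient_map_eq: "quotient_map I x = (\<lambda>i. i + x) ` I"
  by (auto simp: quotient_map_def a_r_coset_def')

lemma quotient_map_eq_iff: "quotient_map I x = quotient_map I y \<longleftrightarrow> x - y \<in> I"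
proof
  assume "quotient_map I x = quotient_map I y"
  moreover have "x \<in> quotient_map I x" using zero_mem by (force simp: quotient_map_eq)
  ultimately show "x - y \<in> I" by (auto simp: quotient_map_eq)
next
  have sub: "quotient_map I x \<subseteq> quotient_map I y" if "x - y \<in> I" for x y
  proof
    fix z assume "z \<in> quotient_map I x"
    then obtain i where "i \<in> I" "z = (i + (x - y)) + y" by (auto simp: quotient_map_eq)
    then show "z \<in> quotient_map I y" unfolding quotient_map_eq by (metis add_mem that imageI)
  qed
  assume "x - y \<in> I"
  then show "quotient_map I x = quotient_map I y" using sub diff_commute_mem by blast
qed

lemma mem_quotient_map: "y \<in> quotient_map I x \<Longrightarrow> quotient_map I y = quotient_map I x"
  by (auto simp: quotient_map_eq_iff) (auto simp: quotient_map_eq)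

lemma self_mem_quotient_map: "x \<in> quotient_map I x"
  using zero_mem by (force simp: quotient_map_eq)

lemma quotient_map_eq_zero: "quotient_map I 0 = I"
  by (simp add: quotient_map_eq)

text \<open>In the unions that define scalar multiples and adjoints of a coset all members are one
  and the same coset, so any representative computes them; the infimum of the norms over a coset is
  the distance to \<open>I\<close>.\<close>

lemma quotient_cstar_simps:
  "carrier (quotient_cstar I) = range (quotient_map I)"
  "quotient_map I x \<otimes>\<^bsub>quotient_cstar I\<^esub> quotient_map I y = quotient_map I (x * y)"
  "quotient_map I x \<oplus>\<^bsub>quotient_cstar I\<^esub> quotient_map I y = quotient_map I (x + y)"
  "\<one>\<^bsub>quotient_cstar I\<^esub> = quotient_map I 1"
  "\<zero>\<^bsub>quotient_cstar I\<^esub> = quotient_map I 0"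
  "cscale (quotient_cstar I) c (quotient_map I x) = quotient_map I (c *\<^sub>C x)"
  "cadj (quotient_cstar I) (quotient_map I x) = quotient_map I (adj x)"
  "cnorm (quotient_cstar I) (quotient_map I x) = infdist x I"
proof -
  show "carrier (quotient_cstar I) = range (quotient_map I)"
    by (auto simp: quotient_cstar_def FactRing_def A_RCOSETS_def' quotient_map_def)
  show "quotient_map I x \<otimes>\<^bsub>quotient_cstar I\<^esub> quotient_map I y = quotient_map I (x * y)"
    using rcoset_mult_add[of x y]
    by (simp add: quotient_cstar_def FactRing_def quotient_map_def)
  show "quotient_map I x \<oplus>\<^bsub>quotient_cstar I\<^esub> quotient_map I y = quotient_map I (x + y)"
    using a_rcos_sum[of x y]
    by (simp add: quotient_cstar_def FactRing_def quotient_map_def)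
  show "\<one>\<^bsub>quotient_cstar I\<^esub> = quotient_map I 1" "\<zero>\<^bsub>quotient_cstar I\<^esub> = quotient_map I 0"
    by (simp_all add: quotient_cstar_def FactRing_def quotient_map_eq_zero)
      (simp add: quotient_map_def)
  have c: "quotient_map I (c *\<^sub>C y) = quotient_map I (c *\<^sub>C x)" if "y \<in> quotient_map I x" for y
    using mem_quotient_map[OF that] scaleC_mem[of "y - x" c]
    by (simp add: quotient_map_eq_iff scaleC_diff_right)
  show "cscale (quotient_cstar I) c (quotient_map I x) = quotient_map I (c *\<^sub>C x)"
    unfolding quotient_cstar_def Let_def cstar.select_convs
    by (rule SUP_eq_const) (use self_mem_quotient_map in blast, erule c)
  have a: "quotient_map I (adj y) = quotient_map I (adj x)" if "y \<in> quotient_map I x" for y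
    using mem_quotient_map[OF that] adj_mem[of "y - x"]
    by (simp add: quotient_map_eq_iff adj_diff)
  show "cadj (quotient_cstar I) (quotient_map I x) = quotient_map I (adj x)"
    unfolding quotient_cstar_def Let_def cstar.select_convs
    by (rule SUP_eq_const) (use self_mem_quotient_map in blast, erule a)
  have "norm ` quotient_map I x = (\<lambda>i. dist x i) ` I"
  proof (intro equalityI subsetI)
    fix t assume "t \<in> norm ` quotient_map I x"
    then obtain i where "i \<in> I" "t = norm (i + x)" by (auto simp: quotient_map_eq)
    then have "- i \<in> I" "t = dist x (- i)" by (simp_all add: minus_mem dist_norm add.commute)
    then show "t \<in> (\<lambda>i. dist x i) ` I" by blast
  next
    fix t assume "t \<in> (\<lambda>i. dist x i) ` I"
    then obtain i where "i \<in> I" "t = dist x i" by auto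
    then have "- i + x \<in> quotient_map I x" "t = norm (- i + x)"
      by (simp_all add: minus_mem dist_norm quotient_map_eq)
    then show "t \<in> norm ` quotient_map I x" by blast
  qed
  then show "cnorm (quotient_cstar I) (quotient_map I x) = infdist x I"
    using zero_mem by (auto simp: quotient_cstar_def infdist_def Let_def)
qed

lemma infdist_approx:
  assumes "e > 0" obtains i where "i \<in> I" "norm (x - i) < infdist x I + e"
proof -
  have "\<exists>i\<in>I. dist x i < infdist x I + e"
    using cInf_lessD[of "dist x ` I" "infdist x I + e"] zero_mem assms
    by (auto simp: infdist_def split: if_splits)
  then show ?thesis using that by (auto simp: dist_norm)
qed

lemma infdist_le_norm: "i \<in> I \<Longrightarrow> infdist x I \<le> norm (x - i)"
  using infdist_le[of i I x] by (simp add: dist_norm)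

lemma infdist_cong: "x - y \<in> I \<Longrightarrow> infdist x I = infdist y I"
  by (metis quotient_cstar_simps(8) quotient_map_eq_iff)

lemma infdist_add: "infdist (x + y) I \<le> infdist x I + infdist y I"
proof (rule field_le_epsilon)
  fix e :: real assume "e > 0"
  then have "e / 2 > 0" by simp
  obtain i where i: "i \<in> I" "norm (x - i) < infdist x I + e / 2" by (rule infdist_approx[OF \<open>e / 2 > 0\<close>])
  obtain j where j: "j \<in> I" "norm (y - j) < infdist y I + e / 2" by (rule infdist_approx[OF \<open>e / 2 > 0\<close>])
  have "infdist (x + y) I \<le> norm ((x - i) + (y - j))"
    using infdist_le_norm[OF add_mem[OF i(1) j(1)], of "x + y"] by (simp add: algebra_simps)
  then show "infdist (x + y) I \<le> infdist x I + infdist y I + e"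
    using norm_triangle_ineq[of "x - i" "y - j"] i(2) j(2) by linarith
qed

lemma infdist_mult: "infdist (x * y) I \<le> infdist x I * infdist y I"
proof -
  have "infdist (x * y) I \<le> (infdist x I + e) * (infdist y I + e)" if e: "e > 0" for e
  proof -
    obtain i where i: "i \<in> I" "norm (x - i) < infdist x I + e" by (rule infdist_approx[OF e])
    obtain j where j: "j \<in> I" "norm (y - j) < infdist y I + e" by (rule infdist_approx[OF e])
    have "i * y + (x - i) * j \<in> I" using i j by (intro add_mem mult_left_mem mult_right_mem)
    then have "infdist (x * y) I \<le> norm ((x - i) * (y - j))"
      using infdist_le_norm[of "i * y + (x - i) * j" "x * y"] by (simp add: algebra_simps)
    also have "\<dots> \<le> norm (x - i) * norm (y - j)" by (rule norm_mult_ineq)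
    also have "\<dots> \<le> (infdist x I + e) * (infdist y I + e)"
      using i j e infdist_nonneg[of x I] by (intro mult_mono) auto
    finally show ?thesis .
  qed
  then have "eventually (\<lambda>e. infdist (x * y) I \<le> (infdist x I + e) * (infdist y I + e)) (at_right 0)"
    by (auto simp: eventually_at_filter)
  moreover have "((\<lambda>e. (infdist x I + e) * (infdist y I + e)) \<longlongrightarrow>
      (infdist x I + 0) * (infdist y I + 0)) (at_right 0)"
    by (intro tendsto_intros)
  ultimately show ?thesis
    using tendsto_lowerbound by fastforce
qed

lemma infdist_scaleC_le: "infdist (c *\<^sub>C x) I \<le> cmod c * infdist x I"
proof (cases "c = 0")
  case True
  then show ?thesis using infdist_le_norm[OF zero_mem, of 0] by simp
next
  case False
  show ?thesis
  proof (rule field_le_epsilon)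
    fix e :: real assume "e > 0"
    then have "e / cmod c > 0" using False by simp
    then obtain i where i: "i \<in> I" "norm (x - i) < infdist x I + e / cmod c" by (rule infdist_approx)
    have "infdist (c *\<^sub>C x) I \<le> cmod c * norm (x - i)"
      using infdist_le_norm[OF scaleC_mem[OF i(1)], of "c *\<^sub>C x"]
      by (simp flip: norm_scaleC add: scaleC_diff_right)
    also have "\<dots> \<le> cmod c * (infdist x I + e / cmod c)" using i by (intro mult_left_mono) auto
    finally show "infdist (c *\<^sub>C x) I \<le> cmod c * infdist x I + e" using False by (simp add: algebra_simps)
  qed
qed

lemma infdist_scaleC: "infdist (c *\<^sub>C x) I = cmod c * infdist x I"
proof (cases "c = 0")
  case False
  have "infdist x I \<le> cmod (1 / c) * infdist (c *\<^sub>C x) I"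
    using infdist_scaleC_le[of "1 / c" "c *\<^sub>C x"] False by (simp add: scaleC_scaleC)
  then have "cmod c * infdist x I \<le> infdist (c *\<^sub>C x) I"
    using False by (simp add: norm_divide field_simps)
  then show ?thesis using infdist_scaleC_le[of c x] by simp
qed (use infdist_le_norm[OF zero_mem, of 0] infdist_nonneg[of 0 I] in simp)

lemma infdist_adj_le: "infdist (adj x) I \<le> infdist x I"
proof (rule field_le_epsilon)
  fix e :: real assume "e > 0"
  then obtain i where i: "i \<in> I" "norm (x - i) < infdist x I + e" by (rule infdist_approx)
  have "infdist (adj x) I \<le> norm (adj (x - i))"
    using infdist_le_norm[OF adj_mem[OF i(1)], of "adj x"] by (simp add: adj_diff)
  then show "infdist (adj x) I \<le> infdist x I + e" using i by simp
qed

text \<open>The approximate unit is \<open>1 - w\<close>: it lies in \<open>I\<close> because the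
  resolvent presents it as a multiple of \<open>h\<close>, and
  \<open>h - h * (1 - w) = h * w\<close> is small.\<close>

lemma approximate_unit:
  assumes h: "h \<in> I" "adj h = h" and e: "e > 0"
  obtains w where "adj w = w" "norm w \<le> 1" "1 - w \<in> I" "norm (h * w) \<le> e"
proof -
  \<comment> \<open>\<open>c\<close> scales \<open>h\<close> to a contraction; \<open>n\<close> is
    chosen so that the resolvent bound with right-hand side 2 becomes
    \<open>norm (c *\<^sub>R h * w) \<le> c * e\<close>.\<close>
  define c where "c = 1 / (norm h + 1)"
  have c: "c > 0" by (simp add: c_def add_nonneg_pos)
  define n where "n = 2 / (c * e)\<^sup>2"
  have n: "n > 0" using c e by (simp add: n_def)
  have "adj (c *\<^sub>R h) = c *\<^sub>R h" "norm (c *\<^sub>R h) \<le> 1"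
    using c by (simp_all add: adj_scaleR h) (simp add: c_def)
  then obtain w where w: "adj w = w" "norm w \<le> 1" "1 - w = n *\<^sub>R (c *\<^sub>R h * c *\<^sub>R h * w)"
      "n * (norm (c *\<^sub>R h * w))\<^sup>2 \<le> 2"
    using square_resolvent[OF _ _ n] by blast
  have "(norm (c *\<^sub>R h * w))\<^sup>2 \<le> (c * e)\<^sup>2"
    using w(4) c e by (simp add: n_def field_simps)
  then have "c * norm (h * w) \<le> c * e"
    using c e power2_le_imp_le[of "c * norm (h * w)" "c * e"] by simp
  then have "norm (h * w) \<le> e" using c by simp
  moreover have "1 - w \<in> I" unfolding w(3)
    by (intro scaleR_mem mult_right_mem h)
  ultimately show ?thesis using that w by blast
qed

text \<open>The C*-identity of the quotient norm. For the hard inequality, \<open>x * w\<close>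
  represents the coset of \<open>x\<close> when \<open>1 - w\<close> is in \<open>I\<close>, and
  \<open>adj (x * w) * (x * w) = w * (adj x * x - h) * w + w * h * w\<close>, where \<open>h\<close>
  in \<open>I\<close> nearly realises the distance of \<open>adj x * x\<close> and \<open>w\<close>
  makes \<open>h * w\<close> small.\<close>

lemma infdist_adj_mult_self: "infdist (adj x * x) I = (infdist x I)\<^sup>2"
proof (rule antisym)
  have "infdist (adj x * x) I \<le> infdist (adj x) I * infdist x I" by (rule infdist_mult)
  also have "\<dots> \<le> infdist x I * infdist x I"
    by (intro mult_right_mono infdist_adj_le infdist_nonneg)
  finally show "infdist (adj x * x) I \<le> (infdist x I)\<^sup>2" by (simp add: power2_eq_square)
next
  show "(infdist x I)\<^sup>2 \<le> infdist (adj x * x) I"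
  proof (rule field_le_epsilon)
    fix e :: real assume "e > 0"
    then have e: "e / 2 > 0" by simp
    let ?a = "adj x * x"
    obtain i where i: "i \<in> I" "norm (?a - i) < infdist ?a I + e / 2" by (rule infdist_approx[OF e])
    \<comment> \<open>The approximate unit is available for self-adjoint elements; passing to the
      real part of \<open>i\<close> does not increase the distance, \<open>adj x * x\<close> being
      self-adjoint.\<close>
    define h where "h = (1/2) *\<^sub>R (i + adj i)"
    have h: "h \<in> I" "adj h = h"
      using i by (auto simp: h_def adj_scaleR adj_add adj_adj add.commute intro!: scaleR_mem add_mem adj_mem)
    have "(1/2) *\<^sub>R ((?a - i) + adj (?a - i)) = ?a - h"
      using scaleR_half_double[of ?a]
      by (simp add: h_def adj_diff adj_mult adj_adj algebra_simps flip: scaleR_add_right)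
    then have ah: "norm (?a - h) \<le> norm (?a - i)" by (rule half_self_plus_adj) simp_all
    obtain w where w: "adj w = w" "norm w \<le> 1" "1 - w \<in> I" "norm (h * w) \<le> e / 2"
      by (rule approximate_unit[OF h e])
    have ww: "norm (w * z) \<le> norm z" "norm (z * w) \<le> norm z" for z
      by (rule norm_contraction_mult[OF w(2)])+
    have "x * (1 - w) \<in> I" using w by (intro mult_left_mem)
    then have "infdist x I \<le> norm (x * w)" using infdist_le_norm[of "x * (1 - w)" x]
      by (simp add: algebra_simps)
    then have "(infdist x I)\<^sup>2 \<le> (norm (x * w))\<^sup>2" using infdist_nonneg by (intro power_mono)
    also have "\<dots> = norm (w * (?a - h) * w + w * (h * w))"
      using norm_adj_mult_self[of "x * w"] by (simp add: adj_mult w algebra_simps)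
    also have "\<dots> \<le> norm (w * (?a - h) * w) + norm (w * (h * w))" by (rule norm_triangle_ineq)
    also have "\<dots> \<le> norm (?a - h) + norm (h * w)"
      using ww(2)[of "w * (?a - h)"] ww(1)[of "?a - h"] ww(1)[of "h * w"] by linarith
    also have "\<dots> \<le> infdist ?a I + e" using ah i(2) w(4) by simp
    finally show "(infdist x I)\<^sup>2 \<le> infdist ?a I + e" .
  qed
qed

text \<open>Along a subsequence with consecutive distances below \<open>(1/2) ^ k\<close> the
  differences lift to elements \<open>d k\<close> of norm below \<open>(1/2) ^ k\<close>; their sum
  converges in the algebra and produces the limit.\<close>

lemma infdist_complete:
  assumes "\<forall>e>0. \<exists>N. \<forall>m\<ge>N. \<forall>n\<ge>N. infdist (x m - x n) I < e"
  obtains l where "(\<lambda>n. infdist (x n - l) I) \<longlonglongrightarrow> 0"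
proof -
  have "\<exists>N. \<forall>m\<ge>N. \<forall>n\<ge>N. infdist (x m - x n) I < (1/2) ^ k" for k
    using assms by simp
  then obtain N where N: "\<And>k m n. m \<ge> N k \<Longrightarrow> n \<ge> N k \<Longrightarrow> infdist (x m - x n) I < (1/2) ^ k"
    by metis
  \<comment> \<open>Summing the thresholds gives an index monotone in \<open>k\<close>, so that both
    \<open>r k\<close> and \<open>r (Suc k)\<close> are at least \<open>N k\<close>.\<close>
  define r where "r k = (\<Sum>j\<le>k. N j)" for k
  have rN: "r k \<ge> N k" for k unfolding r_def by (rule member_le_sum) auto
  have rS: "r (Suc k) \<ge> N k" for k using rN[of k] by (simp add: r_def)
  have "\<exists>d. d - (x (r (Suc k)) - x (r k)) \<in> I \<and> norm d < (1/2) ^ k" for k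
  proof -
    have "0 < (1/2) ^ k - infdist (x (r (Suc k)) - x (r k)) I" using N[OF rS rN] by simp
    then obtain i where "i \<in> I" "norm (x (r (Suc k)) - x (r k) - i) < (1/2) ^ k"
      using infdist_approx[of "(1/2) ^ k - infdist (x (r (Suc k)) - x (r k)) I" "x (r (Suc k)) - x (r k)"]
      by auto
    then show ?thesis
      by (intro exI[of _ "x (r (Suc k)) - x (r k) - i"]) (simp add: minus_mem)
  qed
  then obtain d where d: "\<And>k. d k - (x (r (Suc k)) - x (r k)) \<in> I" "\<And>k. norm (d k) < (1/2) ^ k"
    by metis
  have "summable d"
  proof (rule summable_comparison_test')
    show "summable (\<lambda>k. (1/2::real) ^ k)" by (simp add: summable_geometric_iff)
  qed (use d(2) less_imp_le in blast)
  then have D: "(\<lambda>k. sum d {..<k}) \<longlonglongrightarrow> suminf d" by (rule summable_LIMSEQ)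
  define l where "l = x (r 0) + suminf d"
  have partial: "x (r 0) + sum d {..<k} - x (r k) \<in> I" for k
  proof (induction k)
    case (Suc k)
    from add_mem[OF Suc d(1)[of k]] show ?case by (simp add: algebra_simps)
  qed (simp add: zero_mem)
  have close: "infdist (x (r k) - l) I \<le> norm (sum d {..<k} - suminf d)" for k
  proof -
    have "infdist (x (r k) - l) I = infdist (sum d {..<k} - suminf d) I"
      by (rule infdist_cong) (use minus_mem[OF partial[of k]] in \<open>simp add: l_def algebra_simps\<close>)
    then show ?thesis using infdist_le_norm[OF zero_mem] by simp
  qed
  have "(\<lambda>n. infdist (x n - l) I) \<longlonglongrightarrow> 0"
  proof (rule LIMSEQ_I)
    fix e :: real assume e: "e > 0"
    then obtain M where M: "\<forall>m\<ge>M. \<forall>n\<ge>M. infdist (x m - x n) I < e / 2"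
      using assms half_gt_zero by blast
    obtain K where K: "\<forall>k\<ge>K. norm (sum d {..<k} - suminf d) < e / 2"
      using LIMSEQ_D[OF D half_gt_zero[OF e]] by blast
    obtain k0 where k0: "\<forall>k\<ge>k0. (1/2::real) ^ k < e / 2"
      using LIMSEQ_D[OF LIMSEQ_power_zero[of "1/2::real"] half_gt_zero[OF e]] by auto
    let ?k = "max K k0"
    have "norm (infdist (x n - l) I - 0) < e" if "n \<ge> r ?k" for n
    proof -
      have "infdist (x n - l) I \<le> infdist (x n - x (r ?k)) I + infdist (x (r ?k) - l) I"
        using infdist_add[of "x n - x (r ?k)" "x (r ?k) - l"] by simp
      also have "infdist (x n - x (r ?k)) I < (1/2) ^ ?k"
        using N[of ?k n "r ?k"] rN[of ?k] that by linarith
      also have "(1/2) ^ ?k < e / 2" using k0 by simp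
      finally have "infdist (x n - l) I < e / 2 + infdist (x (r ?k) - l) I" by simp
      moreover have "infdist (x (r ?k) - l) I < e / 2"
        using close[of ?k] K by (meson le_less_trans max.cobounded1)
      ultimately show ?thesis using infdist_nonneg[of "x n - l" I] by simp
    qed
    then show "\<exists>no. \<forall>n\<ge>no. norm (infdist (x n - l) I - 0) < e" by blast
  qed
  then show ?thesis by (rule that)
qed

section \<open>The quotient C*-algebra and homomorphisms out of it\<close>

lemma ring_quotient_cstar: "ring (quotient_cstar I)"
proof (rule ringI)
  show "abelian_group (quotient_cstar I)"
  proof (rule abelian_groupI)
    show "\<exists>Y\<in>carrier (quotient_cstar I). Y \<oplus>\<^bsub>quotient_cstar I\<^esub> X = \<zero>\<^bsub>quotient_cstar I\<^esub>"
      if "X \<in> carrier (quotient_cstar I)" for X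
    proof -
      obtain x where "X = quotient_map I x" using \<open>X \<in> _\<close> by (auto simp: quotient_cstar_simps)
      then show ?thesis
        by (intro bexI[of _ "quotient_map I (- x)"]) (simp_all add: quotient_cstar_simps)
    qed
  qed (auto simp: quotient_cstar_simps ac_simps)
  show "monoid (quotient_cstar I)"
    by (rule monoidI) (auto simp: quotient_cstar_simps mult.assoc)
qed (auto simp: quotient_cstar_simps algebra_simps)

lemma quotient_cstar_minus:
  "quotient_map I x \<ominus>\<^bsub>quotient_cstar I\<^esub> quotient_map I y = quotient_map I (x - y)"
proof -
  interpret Q: ring "quotient_cstar I" by (rule ring_quotient_cstar)
  have "\<ominus>\<^bsub>quotient_cstar I\<^esub> quotient_map I y = quotient_map I (- y)"
    by (rule Q.minus_equality) (simp_all add: quotient_cstar_simps)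
  then show ?thesis by (simp add: a_minus_def quotient_cstar_simps)
qed

lemma unital_cstar_quotient: "unital_cstar (quotient_cstar I)"
proof (intro unital_cstar.intro ring_quotient_cstar unital_cstar_axioms.intro)
  fix f :: "nat \<Rightarrow> 't set"
  assume f: "range f \<subseteq> carrier (quotient_cstar I)"
    "\<forall>e>0. \<exists>N. \<forall>m\<ge>N. \<forall>n\<ge>N. cnorm (quotient_cstar I) (f m \<ominus>\<^bsub>quotient_cstar I\<^esub> f n) < e"
  then have "f n \<in> range (quotient_map I)" for n by (auto simp: quotient_cstar_simps)
  then have "\<forall>n. \<exists>x. f n = quotient_map I x" by blast
  then obtain x where x: "\<And>n. f n = quotient_map I (x n)" by metis
  obtain l where "(\<lambda>n. infdist (x n - l) I) \<longlonglongrightarrow> 0"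
    using f(2) by (auto simp: x quotient_cstar_minus quotient_cstar_simps elim: infdist_complete)
  then show "\<exists>l\<in>carrier (quotient_cstar I).
      (\<lambda>n. cnorm (quotient_cstar I) (f n \<ominus>\<^bsub>quotient_cstar I\<^esub> l)) \<longlonglongrightarrow> 0"
    by (intro bexI[of _ "quotient_map I l"]) (simp_all add: x quotient_cstar_minus quotient_cstar_simps)
next
  fix X assume "X \<in> carrier (quotient_cstar I)"
  then obtain x where x: "X = quotient_map I x" by (auto simp: quotient_cstar_simps)
  have "infdist x I = 0 \<longleftrightarrow> x \<in> I"
    using in_closed_iff_infdist_zero[OF closed] zero_mem by blast
  then show "cnorm (quotient_cstar I) X = 0 \<longleftrightarrow> X = \<zero>\<^bsub>quotient_cstar I\<^esub>"
    by (simp add: x quotient_cstar_simps quotient_map_eq_iff)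
qed (auto simp: quotient_cstar_simps scaleC_add_right scaleC_add_left scaleC_scaleC mult_scaleC_left
    mult_scaleC_right adj_adj adj_add adj_scaleC adj_mult infdist_add infdist_mult infdist_scaleC
    infdist_adj_mult_self)

lemma star_hom_quotient_map: "star_hom type_cstar (quotient_cstar I) (quotient_map I)"
  by (auto simp: star_hom_def quotient_cstar_simps)

lemma star_hom_quotient_lift:
  assumes f: "star_hom type_cstar B f" and B: "unital_cstar B"
    and I: "\<And>x. x \<in> I \<Longrightarrow> f x = \<zero>\<^bsub>B\<^esub>"
  obtains g where "star_hom (quotient_cstar I) B g" "\<And>x. g (quotient_map I x) = f x"
proof -
  interpret B: unital_cstar B by (rule B)
  note D = star_hom_typeD[OF f]
  define g where "g X = f (SOME x. x \<in> X)" for X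
  have g: "g (quotient_map I x) = f x" for x
  proof -
    have "(SOME y. y \<in> quotient_map I x) \<in> quotient_map I x"
      by (rule someI) (rule self_mem_quotient_map)
    then obtain i where "i \<in> I" "(SOME y. y \<in> quotient_map I x) = i + x"
      by (auto simp: quotient_map_eq)
    then show ?thesis by (simp add: g_def D I)
  qed
  have "star_hom (quotient_cstar I) B g"
    by (auto simp: star_hom_def quotient_cstar_simps g D)
  then show ?thesis using g that by blast
qed

end

section \<open>The bimodule inside the Toeplitz algebra\<close>

text \<open>Faithfulness is the essential assumption: an isometric \<open>iA\<close> lets norms and
  limits in the coefficient algebra be computed in the ambient one.\<close>

locale faithful_toeplitz_rep =
  fixes \<alpha> L :: "'a::unital_cstar_algebra \<Rightarrow> 'a"
    and iA :: "'a \<Rightarrow> 't::unital_cstar_algebra" and S :: 't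
  assumes hom: "star_hom type_cstar type_cstar iA" and iA_one: "iA 1 = 1" and inj: "inj iA"
    and S_iA: "S * iA a = iA (\<alpha> a) * S" and adj_S_iA: "adj S * iA a * S = iA (L a)"
begin

lemmas iA_simps = star_hom_typeD[OF hom, simplified]

lemma norm_iA: "norm (iA a) = norm a"
  by (rule injective_star_hom_isometric[OF hom iA_one inj])

lemma iA_diff: "iA (a - b) = iA a - iA b"
  using iA_simps(2)[of "a - b" b] by simp

lemma iA_zero: "iA 0 = 0"
  using iA_diff[of 0 0] by simp

lemma bounded_linear_iA: "bounded_linear iA"
  by (rule bounded_linear_intro[where K=1]) (auto simp: iA_simps norm_iA scaleR_eq_scaleC)

lemma iA_inner: "iA (L (adj a * b)) = adj (iA a * S) * (iA b * S)"
  by (simp add: adj_S_iA[symmetric] iA_simps adj_mult mult.assoc)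

definition E :: "'t set" where "E = closure (range (\<lambda>a. iA a * S))"

text \<open>The identification of \<open>E\<close> with the module \<open>M\<^sub>L\<close> of classes of Cauchy sequences; it
  carries \<open>x\<^sup>* y\<close> to \<open>\<langle>x, y\<rangle>\<^sub>L\<close>.\<close>

definition cls :: "'t \<Rightarrow> (nat \<Rightarrow> 'a) set" where
  "cls e = {x. (\<lambda>n. iA (x n) * S) \<longlonglongrightarrow> e}"

lemma closed_E: "closed E" by (simp add: E_def)

lemma iA_S_in_E: "iA a * S \<in> E"
  unfolding E_def by (rule closure_subset[THEN subsetD]) blast

lemma E_sequence:
  assumes "e \<in> E" obtains x where "(\<lambda>n. iA (x n) * S) \<longlonglongrightarrow> e"
proof -
  obtain u where "\<forall>n. u n \<in> range (\<lambda>a. iA a * S)" "u \<longlonglongrightarrow> e"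
    using assms by (auto simp: E_def closure_sequential)
  then have "\<exists>x. \<forall>n. u n = iA (x n) * S" by (intro choice) blast
  then obtain x where "u = (\<lambda>n. iA (x n) * S)" by blast
  with \<open>u \<longlonglongrightarrow> e\<close> show ?thesis using that by blast
qed

lemma E_lim: "(\<lambda>n. iA (x n) * S) \<longlonglongrightarrow> e \<Longrightarrow> e \<in> E"
  by (rule closed_sequentially[OF closed_E iA_S_in_E])

lemma E_add: "e \<in> E \<Longrightarrow> f \<in> E \<Longrightarrow> e + f \<in> E"
proof -
  assume "e \<in> E" "f \<in> E"
  then obtain x y where "(\<lambda>n. iA (x n) * S) \<longlonglongrightarrow> e" "(\<lambda>n. iA (y n) * S) \<longlonglongrightarrow> f"
    by (metis E_sequence)
  from tendsto_add[OF this] show ?thesis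
    by (intro E_lim[of "\<lambda>n. x n + y n"]) (simp add: iA_simps algebra_simps)
qed

lemma E_scaleC: "e \<in> E \<Longrightarrow> c *\<^sub>C e \<in> E"
proof -
  assume "e \<in> E"
  then obtain x where "(\<lambda>n. iA (x n) * S) \<longlonglongrightarrow> e" by (rule E_sequence)
  from tendsto_scaleC[OF this, of c] show ?thesis
    by (intro E_lim[of "\<lambda>n. c *\<^sub>C x n"]) (simp add: iA_simps mult_scaleC_left)
qed

lemma E_left: "e \<in> E \<Longrightarrow> iA a * e \<in> E"
proof -
  assume "e \<in> E"
  then obtain x where "(\<lambda>n. iA (x n) * S) \<longlonglongrightarrow> e" by (rule E_sequence)
  from tendsto_mult[OF tendsto_const[of "iA a"] this] show ?thesis
    by (intro E_lim[of "\<lambda>n. a * x n"]) (simp add: iA_simps mult.assoc)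
qed

lemma right_action: "iA (b * \<alpha> a) * S = iA b * S * iA a"
  by (simp add: iA_simps S_iA mult.assoc)

lemma E_right: "e \<in> E \<Longrightarrow> e * iA a \<in> E"
proof -
  assume "e \<in> E"
  then obtain x where "(\<lambda>n. iA (x n) * S) \<longlonglongrightarrow> e" by (rule E_sequence)
  from tendsto_mult[OF this tendsto_const[of "iA a"]] show ?thesis
    by (intro E_lim[of "\<lambda>n. x n * \<alpha> a"]) (simp add: right_action)
qed

lemma E_scaleR: "e \<in> E \<Longrightarrow> r *\<^sub>R e \<in> E"
  by (simp add: scaleR_eq_scaleC E_scaleC)

lemma E_zero: "0 \<in> E" using iA_S_in_E[of 0] by (simp add: iA_zero)

lemma E_minus: "e \<in> E \<Longrightarrow> - e \<in> E" using E_scaleC[of e "- 1"] by simp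

lemma E_diff: "e \<in> E \<Longrightarrow> f \<in> E \<Longrightarrow> e - f \<in> E" using E_add[of e "- f"] E_minus by simp

lemma subspace_E: "subspace E"
  by (simp add: subspace_def E_zero E_add E_scaleR)

text \<open>The \<open>lim\<close> in \<open>hinner\<close> is meaningful only once convergence is
  known. The images under \<open>iA\<close> converge in the ambient algebra, and an isometric
  \<open>iA\<close> reflects the Cauchy property.\<close>

lemma inner_sequence:
  assumes "(\<lambda>n. iA (x n) * S) \<longlonglongrightarrow> e" "(\<lambda>n. iA (y n) * S) \<longlonglongrightarrow> f"
  shows "iA (lim (\<lambda>n. L (adj (x n) * y n))) = adj e * f"
proof -
  have lim: "(\<lambda>n. iA (L (adj (x n) * y n))) \<longlonglongrightarrow> adj e * f"
    unfolding iA_inner by (intro tendsto_intros assms)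
  then have "Cauchy (\<lambda>n. iA (L (adj (x n) * y n)))" by (simp add: LIMSEQ_imp_Cauchy)
  then have "Cauchy (\<lambda>n. L (adj (x n) * y n))"
    by (simp add: Cauchy_def dist_norm norm_iA flip: iA_diff)
  then have "(\<lambda>n. L (adj (x n) * y n)) \<longlonglongrightarrow> lim (\<lambda>n. L (adj (x n) * y n))"
    by (simp add: Cauchy_convergent_iff convergent_LIMSEQ_iff)
  from bounded_linear.tendsto[OF bounded_linear_iA this] show ?thesis
    using lim LIMSEQ_unique by blast
qed

text \<open>Makes \<open>E\<close> a right Hilbert module over the range of \<open>iA\<close>; in
  particular \<open>e * adj f * g\<close> stays in \<open>E\<close>.\<close>

lemma E_inner:
  assumes "e \<in> E" "f \<in> E" obtains a where "adj e * f = iA a"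
proof -
  obtain x where x: "(\<lambda>n. iA (x n) * S) \<longlonglongrightarrow> e" using assms(1) by (rule E_sequence)
  obtain y where y: "(\<lambda>n. iA (y n) * S) \<longlonglongrightarrow> f" using assms(2) by (rule E_sequence)
  show ?thesis by (rule that) (rule inner_sequence[OF x y, symmetric])
qed

lemma bimod_norm_eq: "bimod_norm L a = norm (iA a * S)"
proof -
  have "norm (L (adj a * a)) = (norm (iA a * S))\<^sup>2"
    by (simp add: norm_iA[symmetric] iA_inner norm_adj_mult_self)
  then show ?thesis by (simp add: bimod_norm_def)
qed

lemma bimod_Cauchy_iff: "bimod_Cauchy L x \<longleftrightarrow> Cauchy (\<lambda>n. iA (x n) * S)"
  by (simp add: bimod_Cauchy_def bimod_norm_eq Cauchy_def dist_norm iA_diff left_diff_distrib)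

text \<open>Limits of \<open>iA (x n) * S\<close> label the classes: two Cauchy sequences are
  related exactly when these limits agree. Module operations, defined through chosen
  representatives, are therefore determined by limits, whichever representatives are chosen.\<close>

lemma bimod_class_eq:
  assumes "(\<lambda>n. iA (x n) * S) \<longlonglongrightarrow> e"
  shows "bimod_class L x = cls e"
proof -
  have "y \<in> bimod_class L x \<longleftrightarrow> (\<lambda>n. iA (y n) * S) \<longlonglongrightarrow> e" for y
  proof
    assume "y \<in> bimod_class L x"
    then have "(\<lambda>n. iA (x n) * S - iA (y n) * S) \<longlonglongrightarrow> 0"
      by (simp add: bimod_class_def bimod_rel_def bimod_norm_eq iA_diff left_diff_distrib
          tendsto_norm_zero_iff)
    from tendsto_diff[OF assms this] show "(\<lambda>n. iA (y n) * S) \<longlonglongrightarrow> e" by simp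
  next
    assume y: "(\<lambda>n. iA (y n) * S) \<longlonglongrightarrow> e"
    from tendsto_norm_zero[OF tendsto_diff[OF assms y, simplified]]
    show "y \<in> bimod_class L x"
      using LIMSEQ_imp_Cauchy[OF y] LIMSEQ_imp_Cauchy[OF assms]
      by (simp add: bimod_class_def bimod_rel_def bimod_norm_eq iA_diff left_diff_distrib
          bimod_Cauchy_iff)
  qed
  then show ?thesis by (auto simp: cls_def)
qed

abbreviation "X \<equiv> bimod \<alpha> L"
abbreviation "Adj \<equiv> adjointables X"

lemma hcarrier_eq: "hcarrier X = cls ` E"
proof (intro equalityI subsetI)
  fix C assume "C \<in> hcarrier X"
  then obtain x where x: "bimod_Cauchy L x" "C = bimod_class L x"
    by (auto simp: bimod_def quotient_def bimod_class_def)
  then obtain e where e: "(\<lambda>n. iA (x n) * S) \<longlonglongrightarrow> e"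
    by (auto simp: bimod_Cauchy_iff Cauchy_convergent_iff convergent_def)
  then show "C \<in> cls ` E" using E_lim[OF e] bimod_class_eq[OF e] x by auto
next
  fix C assume "C \<in> cls ` E"
  then obtain e where "e \<in> E" "C = cls e" by auto
  then obtain x where x: "(\<lambda>n. iA (x n) * S) \<longlonglongrightarrow> e" by (metis E_sequence)
  then have "bimod_Cauchy L x" by (simp add: bimod_Cauchy_iff LIMSEQ_imp_Cauchy)
  then show "C \<in> hcarrier X" using bimod_class_eq[OF x] \<open>C = cls e\<close>
    by (auto simp: bimod_def quotient_def bimod_class_def)
qed

lemma inj_on_cls: "inj_on cls E"
proof (rule inj_onI)
  fix e f assume "e \<in> E" "cls e = cls f"
  moreover obtain x where "(\<lambda>n. iA (x n) * S) \<longlonglongrightarrow> e" using \<open>e \<in> E\<close> by (rule E_sequence)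
  ultimately show "e = f" by (metis (mono_tags) LIMSEQ_unique cls_def mem_Collect_eq)
qed

lemma cls_eq_iff: "e \<in> E \<Longrightarrow> f \<in> E \<Longrightarrow> cls e = cls f \<longleftrightarrow> e = f"
  using inj_on_cls by (auto simp: inj_on_def)

definition un :: "(nat \<Rightarrow> 'a) set \<Rightarrow> 't" where "un = the_inv_into E cls"

lemma un_cls: "e \<in> E \<Longrightarrow> un (cls e) = e"
  by (simp add: un_def the_inv_into_f_f[OF inj_on_cls])

lemma rep_tendsto: "e \<in> E \<Longrightarrow> (\<lambda>n. iA (bimod_rep (cls e) n) * S) \<longlonglongrightarrow> e"
proof -
  assume "e \<in> E"
  then have "\<exists>x. x \<in> cls e" by (metis E_sequence cls_def mem_Collect_eq)
  then have "bimod_rep (cls e) \<in> cls e" unfolding bimod_rep_def by (rule someI_ex)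
  then show ?thesis by (simp add: cls_def)
qed

section \<open>The module operations transported to \<open>E\<close>\<close>

lemma cls_in_hcarrier: "e \<in> E \<Longrightarrow> cls e \<in> hcarrier X" by (simp add: hcarrier_eq)

lemma bimod_q_eq: "bimod_q L a = cls (iA a * S)"
  unfolding bimod_q_def by (rule bimod_class_eq) simp

lemma hzero_eq: "hzero X = cls 0"
  by (simp add: bimod_def bimod_q_eq iA_zero)

lemma hadd_eq: "e \<in> E \<Longrightarrow> f \<in> E \<Longrightarrow> hadd X (cls e) (cls f) = cls (e + f)"
  unfolding bimod_def hmodule.select_convs
  by (rule bimod_class_eq) (simp add: iA_simps distrib_right tendsto_add rep_tendsto)

lemma hscale_eq: "e \<in> E \<Longrightarrow> hscale X c (cls e) = cls (c *\<^sub>C e)"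
  unfolding bimod_def hmodule.select_convs
  by (rule bimod_class_eq) (simp add: iA_simps mult_scaleC_left tendsto_scaleC rep_tendsto)

lemma hright_eq: "e \<in> E \<Longrightarrow> hright X (cls e) a = cls (e * iA a)"
  unfolding bimod_def hmodule.select_convs
  by (rule bimod_class_eq) (simp add: right_action tendsto_mult rep_tendsto)

lemma hleft_eq: "e \<in> E \<Longrightarrow> hleft X a (cls e) = cls (iA a * e)"
  unfolding bimod_def hmodule.select_convs
  by (rule bimod_class_eq) (simp add: iA_simps mult.assoc tendsto_mult rep_tendsto)

lemma hinner_eq: "e \<in> E \<Longrightarrow> f \<in> E \<Longrightarrow> iA (hinner X (cls e) (cls f)) = adj e * f"
  unfolding bimod_def hmodule.select_convs
  by (rule inner_sequence) (simp_all add: rep_tendsto)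

lemma hinner_eq_iff:
  "e \<in> E \<Longrightarrow> f \<in> E \<Longrightarrow> e' \<in> E \<Longrightarrow> f' \<in> E \<Longrightarrow>
    hinner X (cls e) (cls f) = hinner X (cls e') (cls f') \<longleftrightarrow> adj e * f = adj e' * f'"
  by (metis hinner_eq inj injD)

lemma hnorm_eq: "e \<in> E \<Longrightarrow> hnorm X (cls e) = norm e"
  by (simp add: hnorm_def norm_iA[symmetric] hinner_eq norm_adj_mult_self)

section \<open>Adjointable and compact operators\<close>

text \<open>Operators on the module are written as \<open>oper T\<close> with \<open>T\<close> a map
  on the ambient algebra, of which only the restriction to \<open>E\<close> matters.\<close>

definition oper :: "('t \<Rightarrow> 't) \<Rightarrow> (nat \<Rightarrow> 'a) set \<Rightarrow> (nat \<Rightarrow> 'a) set" where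
  "oper T = (\<lambda>x\<in>hcarrier X. cls (T (un x)))"

text \<open>Membership in \<open>carrier Adj\<close>, expressed on \<open>E\<close>. Linearity is
  not a clause; homogeneity is derived from the existence of an adjoint.\<close>

definition adjointable :: "('t \<Rightarrow> 't) \<Rightarrow> bool" where
  "adjointable T \<longleftrightarrow> T ` E \<subseteq> E \<and>
    (\<exists>R. R ` E \<subseteq> E \<and> (\<forall>e\<in>E. \<forall>f\<in>E. adj (T e) * f = adj e * R f)) \<and>
    (\<exists>C. \<forall>e\<in>E. norm (T e) \<le> C * norm e)"

lemma oper_cls: "e \<in> E \<Longrightarrow> oper T (cls e) = cls (T e)"
  by (simp add: oper_def cls_in_hcarrier un_cls)

lemma oper_cong: "(\<And>e. e \<in> E \<Longrightarrow> T e = R e) \<Longrightarrow> oper T = oper R"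
  by (auto simp: oper_def hcarrier_eq un_cls intro!: restrict_ext)

lemma oper_PiE: "T ` E \<subseteq> E \<Longrightarrow> oper T \<in> hcarrier X \<rightarrow>\<^sub>E hcarrier X"
  by (auto simp: oper_def hcarrier_eq un_cls)

lemma oper_of_PiE:
  assumes "t \<in> hcarrier X \<rightarrow>\<^sub>E hcarrier X"
  obtains T where "t = oper T" "T ` E \<subseteq> E"
proof (rule that[of "\<lambda>e. un (t (cls e))"])
  have *: "t (cls e) \<in> cls ` E" if "e \<in> E" for e
    using assms that by (auto simp: hcarrier_eq)
  show "(\<lambda>e. un (t (cls e))) ` E \<subseteq> E"
  proof (rule image_subsetI)
    fix e assume "e \<in> E"
    then obtain f where "f \<in> E" "t (cls e) = cls f" using * by blast
    then show "un (t (cls e)) \<in> E" by (simp add: un_cls)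
  qed
  show "t = oper (\<lambda>e. un (t (cls e)))"
  proof (rule extensionalityI[of _ "hcarrier X"])
    fix x assume "x \<in> hcarrier X"
    then obtain e where e: "e \<in> E" "x = cls e" by (auto simp: hcarrier_eq)
    then obtain f where "f \<in> E" "t x = cls f" using *[of e] by auto
    then show "t x = oper (\<lambda>e. un (t (cls e))) x" using e by (simp add: oper_cls un_cls)
  qed (use assms in \<open>auto simp: oper_def PiE_def\<close>)
qed

lemma oper_eq_iff:
  assumes "T ` E \<subseteq> E" "R ` E \<subseteq> E"
  shows "oper T = oper R \<longleftrightarrow> (\<forall>e\<in>E. T e = R e)"
proof
  assume "oper T = oper R"
  then show "\<forall>e\<in>E. T e = R e" using assms
    by (metis cls_eq_iff image_subset_iff oper_cls)
qed (rule oper_cong, simp)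

lemma is_adjoint_oper:
  assumes "T ` E \<subseteq> E" "R ` E \<subseteq> E"
  shows "is_adjoint X (oper T) (oper R) \<longleftrightarrow> (\<forall>e\<in>E. \<forall>f\<in>E. adj (T e) * f = adj e * R f)"
proof -
  have "oper R \<in> hcarrier X \<rightarrow>\<^sub>E hcarrier X" by (rule oper_PiE) (rule assms)
  moreover have "hinner X (oper T (cls e)) (cls f) = hinner X (cls e) (oper R (cls f))
      \<longleftrightarrow> adj (T e) * f = adj e * R f" if "e \<in> E" "f \<in> E" for e f
    using assms that by (auto simp: oper_cls hinner_eq_iff image_subset_iff)
  ultimately show ?thesis by (simp add: is_adjoint_def hcarrier_eq)
qed

lemma carrier_Adj: "carrier Adj = oper ` {T. adjointable T}"
proof (intro equalityI subsetI)
  fix t assume "t \<in> carrier Adj"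
  then obtain s C where t: "t \<in> hcarrier X \<rightarrow>\<^sub>E hcarrier X" and s: "is_adjoint X t s"
    and C: "\<forall>x\<in>hcarrier X. hnorm X (t x) \<le> C * hnorm X x"
    by (auto simp: adjointables_def)
  obtain T where T: "t = oper T" "T ` E \<subseteq> E" using t by (rule oper_of_PiE)
  obtain R where R: "s = oper R" "R ` E \<subseteq> E"
    using s oper_of_PiE unfolding is_adjoint_def by metis
  have "norm (T e) \<le> C * norm e" if "e \<in> E" for e
    using C[rule_format, OF cls_in_hcarrier[OF that]] T that
    by (simp add: oper_cls hnorm_eq image_subset_iff)
  then have "adjointable T"
    using s T R is_adjoint_oper[OF T(2) R(2)] unfolding adjointable_def by blast
  then show "t \<in> oper ` {T. adjointable T}" using T by blast
next
  fix t assume "t \<in> oper ` {T. adjointable T}"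
  then obtain T R C where T: "t = oper T" "T ` E \<subseteq> E" and R: "R ` E \<subseteq> E"
    "\<forall>e\<in>E. \<forall>f\<in>E. adj (T e) * f = adj e * R f" and C: "\<forall>e\<in>E. norm (T e) \<le> C * norm e"
    by (auto simp: adjointable_def)
  have "is_adjoint X t (oper R)" using is_adjoint_oper[OF T(2) R(1)] R T by simp
  moreover have "\<forall>x\<in>hcarrier X. hnorm X (t x) \<le> C * hnorm X x"
    using C T by (simp add: hcarrier_eq oper_cls hnorm_eq image_subset_iff)
  ultimately show "t \<in> carrier Adj"
    using oper_PiE[OF T(2)] T(1) by (auto simp: adjointables_def)
qed

lemma Adj_zero: "\<zero>\<^bsub>Adj\<^esub> = oper (\<lambda>e. 0)"
  by (simp add: adjointables_def oper_def hzero_eq)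

lemma Adj_add: "T ` E \<subseteq> E \<Longrightarrow> R ` E \<subseteq> E \<Longrightarrow> oper T \<oplus>\<^bsub>Adj\<^esub> oper R = oper (\<lambda>e. T e + R e)"
  by (auto simp: adjointables_def hcarrier_eq oper_cls hadd_eq image_subset_iff
      oper_def[of "\<lambda>e. T e + R e"] un_cls intro!: restrict_ext)

lemma Adj_mult: "R ` E \<subseteq> E \<Longrightarrow> oper T \<otimes>\<^bsub>Adj\<^esub> oper R = oper (\<lambda>e. T (R e))"
  by (auto simp: adjointables_def hcarrier_eq oper_cls image_subset_iff
      oper_def[of "\<lambda>e. T (R e)"] un_cls intro!: restrict_ext)

lemma Adj_cscale: "T ` E \<subseteq> E \<Longrightarrow> cscale Adj c (oper T) = oper (\<lambda>e. c *\<^sub>C T e)"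
  by (auto simp: adjointables_def hcarrier_eq oper_cls hscale_eq image_subset_iff
      oper_def[of "\<lambda>e. c *\<^sub>C T e"] un_cls intro!: restrict_ext)

text \<open>The adjoint is a definite description, so uniqueness is the point: two candidates differ
  at \<open>f\<close> by a vector of \<open>E\<close> orthogonal to all of \<open>E\<close>, itself
  included.\<close>

lemma Adj_cadj:
  assumes "T ` E \<subseteq> E" "R ` E \<subseteq> E" "\<And>e f. e \<in> E \<Longrightarrow> f \<in> E \<Longrightarrow> adj (T e) * f = adj e * R f"
  shows "cadj Adj (oper T) = oper R"
  unfolding adjointables_def cstar.select_convs
proof (rule the_equality)
  show "is_adjoint X (oper T) (oper R)" using assms by (simp add: is_adjoint_oper)
  fix s assume s: "is_adjoint X (oper T) s"
  then obtain R' where R': "s = oper R'" "R' ` E \<subseteq> E"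
    using oper_of_PiE unfolding is_adjoint_def by metis
  have "R' f = R f" if f: "f \<in> E" for f
  proof -
    have "R' f - R f \<in> E" using R' assms f by (intro E_diff) auto
    moreover have "adj e * (R' f - R f) = 0" if "e \<in> E" for e
    proof -
      have "adj (T e) * f = adj e * R' f"
        using s is_adjoint_oper[OF assms(1) R'(2)] R'(1) f that by blast
      then show ?thesis using assms(3)[OF that f] by (simp add: right_diff_distrib)
    qed
    ultimately show ?thesis using adj_mult_self_eq_0[of "R' f - R f"] by simp
  qed
  then show "s = oper R" unfolding R'(1) by (rule oper_cong)
qed

lemma adjointable_uminus: "adjointable T \<Longrightarrow> adjointable (\<lambda>e. - T e)"
  unfolding adjointable_def
proof (elim conjE exE, intro conjI)
  fix R C assume *: "T ` E \<subseteq> E" "R ` E \<subseteq> E" "\<forall>e\<in>E. \<forall>f\<in>E. adj (T e) * f = adj e * R f"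
    "\<forall>e\<in>E. norm (T e) \<le> C * norm e"
  show "(\<lambda>e. - T e) ` E \<subseteq> E" using * by (auto intro!: E_minus)
  show "\<exists>R. R ` E \<subseteq> E \<and> (\<forall>e\<in>E. \<forall>f\<in>E. adj (- T e) * f = adj e * R f)"
    using * by (intro exI[of _ "\<lambda>e. - R e"]) (auto intro!: E_minus simp: adj_minus)
  show "\<exists>C. \<forall>e\<in>E. norm (- T e) \<le> C * norm e" using * by auto
qed

lemma adjointable_add: "adjointable T \<Longrightarrow> adjointable T' \<Longrightarrow> adjointable (\<lambda>e. T e + T' e)"
  unfolding adjointable_def
proof (elim conjE exE, intro conjI)
  fix R C R' C' assume *: "T ` E \<subseteq> E" "R ` E \<subseteq> E" "\<forall>e\<in>E. \<forall>f\<in>E. adj (T e) * f = adj e * R f"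
    "\<forall>e\<in>E. norm (T e) \<le> C * norm e"
    "T' ` E \<subseteq> E" "R' ` E \<subseteq> E" "\<forall>e\<in>E. \<forall>f\<in>E. adj (T' e) * f = adj e * R' f"
    "\<forall>e\<in>E. norm (T' e) \<le> C' * norm e"
  show "(\<lambda>e. T e + T' e) ` E \<subseteq> E" using * by (auto intro!: E_add)
  show "\<exists>R. R ` E \<subseteq> E \<and> (\<forall>e\<in>E. \<forall>f\<in>E. adj (T e + T' e) * f = adj e * R f)"
    using * by (intro exI[of _ "\<lambda>e. R e + R' e"]) (auto intro!: E_add simp: adj_add algebra_simps)
  show "\<exists>C. \<forall>e\<in>E. norm (T e + T' e) \<le> C * norm e"
    using * by (intro exI[of _ "C + C'"]) (auto simp: distrib_right intro!: norm_triangle_le add_mono)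
qed

text \<open>Subtraction in \<open>Adj\<close> goes through the additive inverse, a definite
  description; no ring structure on \<open>Adj\<close> is established beforehand, so the inverse is
  identified directly.\<close>

lemma Adj_minus:
  assumes "adjointable T" "adjointable R"
  shows "oper T \<ominus>\<^bsub>Adj\<^esub> oper R = oper (\<lambda>e. T e - R e)"
proof -
  have im: "T ` E \<subseteq> E" "R ` E \<subseteq> E" using assms by (auto simp: adjointable_def)
  then have im': "(\<lambda>e. - R e) ` E \<subseteq> E" by (auto intro!: E_minus)
  have zero: "(\<lambda>e. 0) ` E \<subseteq> E" by (auto simp: E_zero)
  have "\<ominus>\<^bsub>Adj\<^esub> oper R = oper (\<lambda>e. - R e)"
    unfolding a_inv_def m_inv_def monoid.simps partial_object.simps
  proof (rule the_equality)
    show "oper (\<lambda>e. - R e) \<in> carrier Adj \<and> oper R \<oplus>\<^bsub>Adj\<^esub> oper (\<lambda>e. - R e) = \<zero>\<^bsub>Adj\<^esub> \<and>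
        oper (\<lambda>e. - R e) \<oplus>\<^bsub>Adj\<^esub> oper R = \<zero>\<^bsub>Adj\<^esub>"
      using adjointable_uminus[OF assms(2)] im im' by (simp add: carrier_Adj Adj_add Adj_zero)
    fix y assume y: "y \<in> carrier Adj \<and> oper R \<oplus>\<^bsub>Adj\<^esub> y = \<zero>\<^bsub>Adj\<^esub> \<and> y \<oplus>\<^bsub>Adj\<^esub> oper R = \<zero>\<^bsub>Adj\<^esub>"
    then obtain Y where Y: "y = oper Y" "Y ` E \<subseteq> E" by (auto simp: carrier_Adj adjointable_def)
    have "(\<lambda>e. R e + Y e) ` E \<subseteq> E" using im Y by (auto intro!: E_add)
    moreover have "oper (\<lambda>e. R e + Y e) = oper (\<lambda>e. 0)"
      using y im Y by (simp add: Adj_add Adj_zero)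
    ultimately have "\<forall>e\<in>E. R e + Y e = 0" using zero by (simp add: oper_eq_iff)
    then show "y = oper (\<lambda>e. - R e)" unfolding Y(1)
      by (intro oper_cong) (simp add: eq_neg_iff_add_eq_0 add.commute)
  qed
  then show ?thesis using im im' by (simp add: a_minus_def Adj_add)
qed

text \<open>Moving \<open>T\<close> to the other side shows that the defect \<open>?d\<close>, a
  vector of \<open>E\<close>, is orthogonal to \<open>E\<close>. Homogeneity then carries bounds
  from the unit ball to all of \<open>E\<close>.\<close>

lemma adjointable_scaleR:
  assumes "adjointable T" "e \<in> E"
  shows "T (r *\<^sub>R e) = r *\<^sub>R T e"
proof -
  obtain R where R: "T ` E \<subseteq> E" "R ` E \<subseteq> E" "\<forall>e\<in>E. \<forall>f\<in>E. adj (T e) * f = adj e * R f"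
    using assms(1) by (auto simp: adjointable_def)
  let ?d = "T (r *\<^sub>R e) - r *\<^sub>R T e"
  have "?d \<in> E" using R assms(2) by (auto intro!: E_diff E_scaleR)
  moreover have "adj ?d * f = 0" if "f \<in> E" for f
    using R(3) that assms(2) by (simp add: E_scaleR adj_diff adj_scaleR left_diff_distrib)
  ultimately show ?thesis using adj_mult_self_eq_0[of ?d] by simp
qed

lemma cnorm_Adj_bound:
  assumes T: "adjointable T" and e: "e \<in> E"
  shows "norm (T e) \<le> cnorm Adj (oper T) * norm e"
proof -
  obtain C where im: "T ` E \<subseteq> E" and C: "\<forall>e\<in>E. norm (T e) \<le> C * norm e"
    using T by (auto simp: adjointable_def)
  have unit: "norm (T f) \<le> cnorm Adj (oper T)" if f: "f \<in> E" "norm f \<le> 1" for f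
    unfolding adjointables_def cstar.select_convs
  proof (rule cSup_upper)
    show "norm (T f) \<in> (\<lambda>x. hnorm X (oper T x)) ` {x \<in> hcarrier X. hnorm X x \<le> 1}"
      using f im by (intro image_eqI[of _ _ "cls f"]) (auto simp: oper_cls hnorm_eq cls_in_hcarrier)
    \<comment> \<open>The absolute value is taken because \<open>C\<close> may be negative when
      \<open>E\<close> is zero.\<close>
    have "norm (T g) \<le> \<bar>C\<bar>" if "g \<in> E" "norm g \<le> 1" for g
    proof -
      have "norm (T g) \<le> C * norm g" using C that by blast
      also have "\<dots> \<le> \<bar>C\<bar> * 1" using that by (intro mult_mono) auto
      finally show ?thesis by simp
    qed
    then show "bdd_above ((\<lambda>x. hnorm X (oper T x)) ` {x \<in> hcarrier X. hnorm X x \<le> 1})"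
      using im by (intro bdd_aboveI[of _ "\<bar>C\<bar>"]) (auto simp: hcarrier_eq oper_cls hnorm_eq)
  qed
  show ?thesis
  proof (cases "e = 0")
    case True
    then show ?thesis using C e by auto
  next
    case False
    have "norm (T ((1 / norm e) *\<^sub>R e)) \<le> cnorm Adj (oper T)"
      by (rule unit) (use False e in \<open>simp_all add: E_scaleR\<close>)
    then show ?thesis using False by (simp add: adjointable_scaleR[OF T e] field_simps)
  qed
qed

lemma cnorm_Adj_le:
  assumes "T ` E \<subseteq> E" "c \<ge> 0" "\<And>e. e \<in> E \<Longrightarrow> norm (T e) \<le> c * norm e"
  shows "cnorm Adj (oper T) \<le> c"
  unfolding adjointables_def cstar.select_convs
proof (rule cSup_least)
  show "(\<lambda>x. hnorm X (oper T x)) ` {x \<in> hcarrier X. hnorm X x \<le> 1} \<noteq> {}"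
    using cls_in_hcarrier[OF E_zero] hnorm_eq[OF E_zero] by force
  fix t assume "t \<in> (\<lambda>x. hnorm X (oper T x)) ` {x \<in> hcarrier X. hnorm X x \<le> 1}"
  then obtain e where e: "e \<in> E" "norm e \<le> 1" "t = norm (T e)"
    using assms(1) by (auto simp: hcarrier_eq oper_cls hnorm_eq)
  then have "t \<le> c * norm e" using assms(3) by simp
  also have "\<dots> \<le> c" using e(2) assms(2) mult_left_mono[of "norm e" 1 c] by simp
  finally show "t \<le> c" .
qed

end

lemma subspace_closure:
  fixes V :: "'a::real_normed_vector set"
  assumes V: "subspace V"
  shows "subspace (closure V)"
  unfolding subspace_def
proof (intro conjI ballI allI)
  show "0 \<in> closure V" using subspace_0[OF V] closure_subset by blast
  fix x assume "x \<in> closure V"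
  then obtain u where u: "\<And>n. u n \<in> V" "u \<longlonglongrightarrow> x" by (auto simp: closure_sequential)
  show "c *\<^sub>R x \<in> closure V" for c
    unfolding closure_sequential
    by (intro exI[of _ "\<lambda>n. c *\<^sub>R u n"]) (simp add: subspace_scale[OF V] u tendsto_scaleR)
  fix y assume "y \<in> closure V"
  then obtain v where v: "\<And>n. v n \<in> V" "v \<longlonglongrightarrow> y" by (auto simp: closure_sequential)
  show "x + y \<in> closure V"
    unfolding closure_sequential
    by (intro exI[of _ "\<lambda>n. u n + v n"]) (simp add: subspace_add[OF V] u v tendsto_add)
qed

context faithful_toeplitz_rep
begin

section \<open>Compact operators as left multiplications by elements of \<open>K\<close>\<close>

abbreviation "Lam k \<equiv> oper ((*) k)"

text \<open>These elements act on \<open>E\<close> as adjointable operators. \<open>U\<close>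
  contains both \<open>K\<close> and the range of \<open>iA\<close>, so compact operators and the
  left action can be compared inside it.\<close>

definition U :: "'t set" where "U = {k. \<forall>e\<in>E. k * e \<in> E \<and> adj k * e \<in> E}"

text \<open>The real span is already complex, since a scalar can be absorbed into
  \<open>e\<close>.\<close>

definition M :: "'t set" where "M = span {e * adj f |e f. e \<in> E \<and> f \<in> E}"

definition K :: "'t set" where "K = closure M"

lemma U_image: "k \<in> U \<Longrightarrow> (*) k ` E \<subseteq> E" "k \<in> U \<Longrightarrow> (*) (adj k) ` E \<subseteq> E"
  by (auto simp: U_def)

lemma iA_in_U: "iA a \<in> U"
  using E_left by (auto simp: U_def simp flip: iA_simps(4,5))

lemma rank_one_image: "e \<in> E \<Longrightarrow> f \<in> E \<Longrightarrow> g \<in> E \<Longrightarrow> e * adj f * g \<in> E"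
  by (metis E_inner E_right mult.assoc)

lemma rank_one_in_U: "e \<in> E \<Longrightarrow> f \<in> E \<Longrightarrow> e * adj f \<in> U"
  by (auto simp: U_def rank_one_image adj_mult adj_adj)

lemma subspace_U: "subspace U"
  by (auto simp: subspace_def U_def E_zero E_add E_scaleR adj_add adj_scaleR distrib_right)

lemma closed_U: "closed U"
proof -
  have "U = (\<Inter>e\<in>E. (\<lambda>k. k * e) -` E \<inter> (\<lambda>k. adj k * e) -` E)"
    by (auto simp: U_def)
  also have "closed \<dots>"
    by (intro closed_INT ballI closed_Int closed_vimage closed_E)
      (auto intro!: continuous_intros bounded_linear.continuous_on[OF bounded_linear_adj])
  finally show ?thesis .
qed

lemma K_minimal:
  assumes "bounded_linear g" "subspace V" "closed V" "k \<in> K"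
    and gen: "\<And>e f. e \<in> E \<Longrightarrow> f \<in> E \<Longrightarrow> g (e * adj f) \<in> V"
  shows "g k \<in> V"
proof -
  interpret g: bounded_linear g by (rule assms(1))
  have "M \<subseteq> g -` V" unfolding M_def
    by (rule span_minimal) (use gen assms(2) in \<open>auto intro!: linear_subspace_vimage g.linear\<close>)
  moreover have "closed (g -` V)"
    by (intro closed_vimage assms(3) g.continuous_on continuous_on_id)
  ultimately have "K \<subseteq> g -` V" unfolding K_def by (rule closure_minimal)
  then show ?thesis using assms(4) by blast
qed

lemma closed_K: "closed K" and subspace_K: "subspace K" and M_subset_K: "M \<subseteq> K"
  by (simp_all add: K_def M_def subspace_closure closure_subset)

lemma rank_one_in_M: "e \<in> E \<Longrightarrow> f \<in> E \<Longrightarrow> e * adj f \<in> M"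
  unfolding M_def by (rule span_base) blast

lemma rank_one_in_K: "e \<in> E \<Longrightarrow> f \<in> E \<Longrightarrow> e * adj f \<in> K"
  using rank_one_in_M M_subset_K by blast

lemma K_subset_U: "K \<subseteq> U"
  using K_minimal[OF bounded_linear_ident subspace_U closed_U] rank_one_in_U by blast

lemma adj_in_K: "k \<in> K \<Longrightarrow> adj k \<in> K"
  by (rule K_minimal[OF bounded_linear_adj subspace_K closed_K])
    (simp_all add: adj_mult adj_adj rank_one_in_K)

lemma mult_in_K: "k \<in> U \<Longrightarrow> l \<in> K \<Longrightarrow> k * l \<in> K"
  by (rule K_minimal[OF bounded_linear_mult_right subspace_K closed_K])
    (auto simp: mult.assoc[symmetric] U_def intro!: rank_one_in_K)

lemma add_in_K: "k \<in> K \<Longrightarrow> l \<in> K \<Longrightarrow> k + l \<in> K"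
  and diff_in_K: "k \<in> K \<Longrightarrow> l \<in> K \<Longrightarrow> k - l \<in> K"
  using subspace_K by (auto intro: subspace_add subspace_diff)

lemma scaleC_in_K: "k \<in> K \<Longrightarrow> c *\<^sub>C k \<in> K"
  by (rule K_minimal[OF bounded_linear_scaleC subspace_K closed_K])
    (auto simp: mult_scaleC_left[symmetric] intro!: rank_one_in_K E_scaleC)

text \<open>Connects \<open>K\<close> with the closed span in the definition of redundancies. The
  products \<open>e * adj f\<close> are reached by density in two rounds, first in \<open>f\<close>
  and then in \<open>e\<close>.\<close>

lemma K_eq: "K = closure (span {iA b * S * adj S * iA c |b c. True})" (is "K = ?K0")
proof (rule equalityI)
  have sub: "subspace ?K0" by (rule subspace_closure) simp
  have E1: "iA b * S * adj f \<in> ?K0" if "f \<in> E" for b f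
  proof -
    have "range (\<lambda>a. iA a * S) \<subseteq> (\<lambda>f. iA b * S * adj f) -` ?K0"
    proof (rule image_subsetI)
      fix a
      have "iA b * S * adj (iA a * S) = iA b * S * adj S * iA (adj a)"
        by (simp add: adj_mult iA_simps mult.assoc)
      then show "iA a * S \<in> (\<lambda>f. iA b * S * adj f) -` ?K0"
        by (auto intro!: subsetD[OF closure_subset] span_base)
    qed
    moreover have "closed ((\<lambda>f. iA b * S * adj f) -` ?K0)"
      by (intro closed_vimage closed_closure continuous_intros
          bounded_linear.continuous_on[OF bounded_linear_adj])
    ultimately show ?thesis using that unfolding E_def
      using closure_minimal by blast
  qed
  have "e * adj f \<in> ?K0" if "e \<in> E" "f \<in> E" for e f
  proof -
    have "range (\<lambda>a. iA a * S) \<subseteq> (\<lambda>e. e * adj f) -` ?K0" using E1[OF that(2)] by auto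
    moreover have "closed ((\<lambda>e. e * adj f) -` ?K0)"
      by (intro closed_vimage closed_closure continuous_intros)
    ultimately show ?thesis using that(1) unfolding E_def
      using closure_minimal by blast
  qed
  then show "K \<subseteq> ?K0" using K_minimal[OF bounded_linear_ident sub closed_closure] by blast
  have "iA b * S * adj S * iA c = (iA b * S) * adj (iA (adj c) * S)" for b c
    by (simp add: adj_mult iA_simps adj_adj mult.assoc)
  then have "{iA b * S * adj S * iA c |b c. True} \<subseteq> M"
    using rank_one_in_M iA_S_in_E by auto
  then have "span {iA b * S * adj S * iA c |b c. True} \<subseteq> M"
    by (rule span_minimal) (simp add: M_def)
  then show "?K0 \<subseteq> K" unfolding K_def by (rule closure_mono)
qed

text \<open>As \<open>m\<close> is a finite combination of products \<open>e * adj f\<close>, the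
  norm of \<open>z * m\<close> is controlled by \<open>z\<close> on \<open>E\<close>. The constant
  comes from a decomposition of \<open>m\<close> and is independent of \<open>z\<close>; with powers
  in place of \<open>z\<close> it is negligible against exponential growth.\<close>

lemma M_mult_bound:
  assumes "m \<in> M"
  obtains C where "C \<ge> 0"
    "\<And>z d. d \<ge> 0 \<Longrightarrow> (\<And>e. e \<in> E \<Longrightarrow> norm (z * e) \<le> d * norm e) \<Longrightarrow> norm (z * m) \<le> C * d"
proof -
  have "\<exists>C\<ge>0. \<forall>z d. d \<ge> 0 \<longrightarrow> (\<forall>e\<in>E. norm (z * e) \<le> d * norm e) \<longrightarrow> norm (z * m) \<le> C * d"
    using assms unfolding M_def
  proof (induction rule: span_induct_alt)
    case base
    then show ?case by (intro exI[of _ 0]) simp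
  next
    case (step r x y)
    then obtain e f C where x: "x = e * adj f" "e \<in> E" and C: "C \<ge> 0"
      "\<And>z d. d \<ge> 0 \<Longrightarrow> \<forall>e\<in>E. norm (z * e) \<le> d * norm e \<Longrightarrow> norm (z * y) \<le> C * d" by auto
    have "norm (z * (r *\<^sub>R x + y)) \<le> (\<bar>r\<bar> * (norm e * norm f) + C) * d"
      if "d \<ge> 0" "\<forall>e\<in>E. norm (z * e) \<le> d * norm e" for z d
    proof -
      have "norm (z * (r *\<^sub>R x + y)) \<le> norm (r *\<^sub>R (z * x)) + norm (z * y)"
        using norm_triangle_ineq[of "r *\<^sub>R (z * x)" "z * y"] by (simp add: distrib_left)
      moreover have "norm (z * x) \<le> norm (z * e) * norm f"
        using norm_mult_ineq[of "z * e" "adj f"] by (simp add: x mult.assoc)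
      moreover have "norm (z * e) * norm f \<le> d * norm e * norm f"
        using that x by (intro mult_right_mono) auto
      ultimately show ?thesis
        using C(2)[OF that] mult_left_mono[of "norm (z * x)" "d * norm e * norm f" "\<bar>r\<bar>"]
        by (simp add: algebra_simps)
    qed
    then show ?case using C(1) by (intro exI[of _ "\<bar>r\<bar> * (norm e * norm f) + C"]) simp
  qed
  then show ?thesis using that by blast
qed

text \<open>If \<open>d\<close> bounds the action of \<open>h = m m\<^sup>*\<close> on \<open>E\<close>, then \<open>\<parallel>h\<^sup>n\<^sup>+\<^sup>1\<parallel> = O(d\<^sup>n)\<close>, whereas the
  C*-identity gives \<open>\<parallel>h\<^sup>n\<parallel> = \<parallel>h\<parallel>\<^sup>n\<close> for \<open>n = 2\<^sup>j\<close>.\<close>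

lemma M_norm_le:
  assumes m: "m \<in> M" and c: "c \<ge> 0" and bound: "\<And>e. e \<in> E \<Longrightarrow> norm (m * e) \<le> c * norm e"
  shows "norm m \<le> c"
proof -
  have mU: "m \<in> U" using m M_subset_K K_subset_U by blast
  have bound': "norm (adj m * e) \<le> c * norm e" if e: "e \<in> E" for e
  proof (cases "norm (adj m * e) = 0")
    case False
    have me: "adj m * e \<in> E" using mU e by (auto simp: U_def)
    have "norm (adj m * e) * norm (adj m * e) = norm (adj e * (m * (adj m * e)))"
      using norm_adj_mult_self[of "adj m * e"] by (simp add: adj_mult adj_adj mult.assoc power2_eq_square)
    also have "\<dots> \<le> norm e * (c * norm (adj m * e))"
      using norm_mult_ineq[of "adj e" "m * (adj m * e)"] bound[OF me]
        mult_left_mono[of _ _ "norm e"] by (simp, meson norm_ge_zero order_trans)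
    finally show ?thesis using False by (simp add: mult.assoc[symmetric] mult.commute)
  qed (simp add: c)
  define h where "h = m * adj m"
  define d where "d = c * c"
  have d: "d \<ge> 0" using c by (simp add: d_def)
  have hE: "h * e \<in> E \<and> norm (h * e) \<le> d * norm e" if e: "e \<in> E" for e
  proof -
    have me: "adj m * e \<in> E" using mU e by (auto simp: U_def)
    then have "h * e \<in> E" using mU by (auto simp: U_def h_def mult.assoc)
    moreover have "norm (h * e) \<le> c * (c * norm e)"
      using bound[OF me] mult_left_mono[OF bound'[OF e] c] by (simp add: h_def mult.assoc)
    ultimately show ?thesis by (simp add: d_def mult.assoc)
  qed
  have hn: "h ^ n * e \<in> E \<and> norm (h ^ n * e) \<le> d ^ n * norm e" if e: "e \<in> E" for n e
  proof (induction n)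
    case (Suc n)
    have "norm (h * (h ^ n * e)) \<le> d * norm (h ^ n * e)" using hE Suc by blast
    also have "\<dots> \<le> d * (d ^ n * norm e)" using Suc d by (intro mult_left_mono) auto
    finally show ?case using hE Suc by (simp add: mult.assoc)
  qed (use e in simp)
  obtain C where C: "C \<ge> 0"
    "\<And>z d. d \<ge> 0 \<Longrightarrow> (\<And>e. e \<in> E \<Longrightarrow> norm (z * e) \<le> d * norm e) \<Longrightarrow> norm (z * m) \<le> C * d"
    using M_mult_bound[OF m] by metis
  \<comment> \<open>Writing \<open>h ^ Suc n\<close> as \<open>h ^ n * m * adj m\<close> leaves one
    factor \<open>m\<close> through which the bound of \<open>h ^ n\<close> on \<open>E\<close>
    becomes a bound in norm.\<close>
  have hpow: "norm (h ^ Suc n) \<le> C * norm m * d ^ n" for n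
  proof -
    have "norm (h ^ Suc n) = norm (h ^ n * m * adj m)"
      by (simp only: power_Suc2) (simp add: h_def mult.assoc)
    also have "\<dots> \<le> norm (h ^ n * m) * norm m" using norm_mult_ineq[of "h ^ n * m" "adj m"] by simp
    also have "\<dots> \<le> C * d ^ n * norm m" using C(2)[of "d ^ n" "h ^ n"] hn d by (intro mult_right_mono) auto
    finally show ?thesis by (simp add: algebra_simps)
  qed
  have hsa: "adj h = h" by (simp add: h_def adj_mult adj_adj)
  have "adj (h ^ n) = h ^ n" for n
    by (induction n) (simp_all add: adj_mult hsa power_commutes)
  then have h2: "norm (h ^ (2 ^ j)) = norm h ^ (2 ^ j)" for j
    by (induction j) (simp_all add: mult_2 power_add norm_square_selfadjoint power2_eq_square)
  have "norm h \<le> d"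
  proof (rule ccontr)
    assume "\<not> norm h \<le> d"
    then have hd: "d < norm h" by simp
    have pow: "norm h ^ (2 ^ j) \<le> C * norm m * d ^ (2 ^ j - 1)" for j
      using hpow[of "2 ^ j - 1"] h2[of j] by simp
    show False
    proof (cases "d = 0")
      case True
      \<comment> \<open>\<open>j = 1\<close> is the least choice with a positive exponent:
        \<open>d ^ (2 ^ 0 - 1)\<close> is 1 even for \<open>d = 0\<close>.\<close>
      then show False using pow[of 1] mult_pos_pos[OF hd[unfolded True] hd[unfolded True]]
        by (simp add: power2_eq_square)
    next
      case False
      with d have d: "d > 0" by simp
      then have "1 < norm h / d" using hd by simp
      then obtain n where n: "C * norm m / d < (norm h / d) ^ n"
        using real_arch_pow by blast
      also have "\<dots> \<le> (norm h / d) ^ (2 ^ n)"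
        using \<open>1 < norm h / d\<close> less_exp[of n] by (intro power_increasing) auto
      also have "\<dots> \<le> C * norm m * d ^ (2 ^ n - 1) / d ^ (2 ^ n)"
        using pow[of n] d by (simp add: power_divide divide_right_mono)
      also have "d ^ (2 ^ n) = d * d ^ (2 ^ n - 1)"
        by (metis power_eq_if power_not_zero zero_neq_numeral)
      finally show False using d by simp
    qed
  qed
  then have "(norm m)\<^sup>2 \<le> c\<^sup>2" by (simp add: h_def d_def norm_self_mult_adj power2_eq_square)
  then show ?thesis using c by (rule power2_le_imp_le)
qed

text \<open>An element of \<open>M\<close> close to \<open>k\<close> obeys almost the same bound on
  \<open>E\<close>. The lemma makes \<open>Lam\<close> isometric, hence injective, on
  \<open>K\<close>.\<close>

lemma K_norm_le:
  assumes k: "k \<in> K" and c: "c \<ge> 0" and bound: "\<And>e. e \<in> E \<Longrightarrow> norm (k * e) \<le> c * norm e"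
  shows "norm k \<le> c"
proof (rule field_le_epsilon)
  fix \<epsilon> :: real assume "\<epsilon> > 0"
  then have "\<epsilon> / 2 > 0" by simp
  then obtain m where m: "m \<in> M" "dist m k < \<epsilon> / 2"
    using k unfolding K_def closure_approachable by blast
  have "norm m \<le> c + \<epsilon> / 2"
  proof (rule M_norm_le[OF m(1)])
    fix e assume e: "e \<in> E"
    have "norm (m * e) \<le> norm (k * e) + norm ((m - k) * e)"
      using norm_triangle_ineq[of "k * e" "(m - k) * e"] by (simp add: algebra_simps)
    also have "\<dots> \<le> c * norm e + \<epsilon> / 2 * norm e"
    proof (rule add_mono[OF bound[OF e]])
      have "norm ((m - k) * e) \<le> norm (m - k) * norm e" by (rule norm_mult_ineq)
      also have "\<dots> \<le> \<epsilon> / 2 * norm e" using m(2) by (intro mult_right_mono) (auto simp: dist_norm)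
      finally show "norm ((m - k) * e) \<le> \<epsilon> / 2 * norm e" .
    qed
    finally show "norm (m * e) \<le> (c + \<epsilon> / 2) * norm e" by (simp add: algebra_simps)
  qed (use c \<open>\<epsilon> > 0\<close> in simp)
  moreover have "norm k \<le> norm m + dist m k"
    using norm_triangle_ineq2[of k m] by (simp add: dist_norm norm_minus_commute)
  ultimately show "norm k \<le> c + \<epsilon>" using m(2) by simp
qed

lemma adjointable_U: "k \<in> U \<Longrightarrow> adjointable ((*) k)"
  unfolding adjointable_def
proof (intro conjI)
  assume "k \<in> U"
  then show "(*) k ` E \<subseteq> E" by (rule U_image)
  show "\<exists>R. R ` E \<subseteq> E \<and> (\<forall>e\<in>E. \<forall>f\<in>E. adj (k * e) * f = adj e * R f)"
    using U_image(2)[OF \<open>k \<in> U\<close>] by (intro exI[of _ "(*) (adj k)"]) (simp add: adj_mult mult.assoc)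
  show "\<exists>C. \<forall>e\<in>E. norm (k * e) \<le> C * norm e" using norm_mult_ineq by blast
qed

lemma Lam_in_carrier: "k \<in> U \<Longrightarrow> Lam k \<in> carrier Adj"
  using adjointable_U by (auto simp: carrier_Adj)

lemma Lam_minus: "k \<in> U \<Longrightarrow> l \<in> U \<Longrightarrow> Lam k \<ominus>\<^bsub>Adj\<^esub> Lam l = Lam (k - l)"
  by (simp add: Adj_minus adjointable_U) (rule oper_cong, simp add: left_diff_distrib)

lemma Lam_add: "k \<in> U \<Longrightarrow> l \<in> U \<Longrightarrow> Lam k \<oplus>\<^bsub>Adj\<^esub> Lam l = Lam (k + l)"
  by (simp add: Adj_add U_image) (rule oper_cong, simp add: distrib_right)

lemma Lam_mult: "l \<in> U \<Longrightarrow> Lam k \<otimes>\<^bsub>Adj\<^esub> Lam l = Lam (k * l)"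
  by (simp add: Adj_mult U_image) (rule oper_cong, simp add: mult.assoc)

lemma Lam_cscale: "k \<in> U \<Longrightarrow> cscale Adj c (Lam k) = Lam (c *\<^sub>C k)"
  by (simp add: Adj_cscale U_image) (rule oper_cong, simp add: mult_scaleC_left)

lemma Lam_cadj: "k \<in> U \<Longrightarrow> cadj Adj (Lam k) = Lam (adj k)"
  by (rule Adj_cadj) (simp_all add: U_image adj_mult mult.assoc)

lemma cnorm_Lam_le: "k \<in> U \<Longrightarrow> cnorm Adj (Lam k) \<le> norm k"
  by (rule cnorm_Adj_le) (simp_all add: U_image norm_mult_ineq)

text \<open>\<open>cnorm\<close> is a supremum of reals, so its sign needs an argument; when
  \<open>E\<close> is zero the unit ball is the single class \<open>cls 0\<close>. The sign lets
  \<open>cnorm Adj (Lam k)\<close> serve as the bound in \<open>K_norm_le\<close>.\<close>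

lemma cnorm_Lam_nonneg: "k \<in> U \<Longrightarrow> 0 \<le> cnorm Adj (Lam k)"
proof -
  assume k: "k \<in> U"
  show ?thesis
  proof (cases "\<exists>e\<in>E. e \<noteq> 0")
    case True
    then obtain e where e: "e \<in> E" "e \<noteq> 0" by blast
    have "0 \<le> cnorm Adj (Lam k) * norm e"
      using cnorm_Adj_bound[OF adjointable_U[OF k] e(1)] norm_ge_zero order_trans by blast
    then show ?thesis using e(2) by (simp add: zero_le_mult_iff)
  next
    case False
    then have "{x \<in> hcarrier X. hnorm X x \<le> 1} = {cls 0}" 
      using E_zero by (auto simp: hcarrier_eq hnorm_eq)
    then show ?thesis using E_zero by (simp add: adjointables_def oper_cls hnorm_eq)
  qed
qed

lemma norm_eq_cnorm_Lam: "k \<in> K \<Longrightarrow> cnorm Adj (Lam k) = norm k"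
  using K_subset_U cnorm_Lam_le[of k] cnorm_Lam_nonneg[of k]
    K_norm_le[of k "cnorm Adj (Lam k)"] cnorm_Adj_bound[OF adjointable_U, of k] by fastforce

lemma theta_eq: "e \<in> E \<Longrightarrow> f \<in> E \<Longrightarrow> theta X (cls e) (cls f) = Lam (e * adj f)"
  unfolding theta_def oper_def
  by (rule restrict_ext) (auto simp: hcarrier_eq hright_eq hinner_eq un_cls mult.assoc)

lemma theta_span_eq: "theta_span X = Lam ` M"
proof (intro equalityI subsetI)
  fix t assume "t \<in> theta_span X"
  then show "t \<in> Lam ` M"
  proof induction
    case zero
    have "\<zero>\<^bsub>Adj\<^esub> = Lam 0" unfolding Adj_zero by (rule oper_cong) simp
    then show ?case by (auto simp: M_def span_zero)
  next
    case (add t x y c)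
    then obtain e f m where x: "x = cls e" "y = cls f" "e \<in> E" "f \<in> E" "t = Lam m" "m \<in> M"
      by (auto simp: hcarrier_eq)
    have "(c *\<^sub>C e) * adj f + m \<in> M"
      using rank_one_in_M[OF E_scaleC[OF x(3), of c] x(4)] x(6) unfolding M_def by (rule span_add)
    moreover have "m \<in> U" "(c *\<^sub>C e) * adj f \<in> U"
      using x(6) M_subset_K K_subset_U rank_one_in_U[OF E_scaleC[OF x(3), of c] x(4)] by auto
    ultimately show ?case using x
      by (auto simp: theta_eq Lam_cscale Lam_add rank_one_in_U mult_scaleC_left)
  qed
next
  fix t assume "t \<in> Lam ` M"
  then obtain m where m: "t = Lam m" "m \<in> span {e * adj f |e f. e \<in> E \<and> f \<in> E}"
    by (auto simp: M_def)
  from m(2) have "m \<in> U \<and> Lam m \<in> theta_span X"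
  proof (induction rule: span_induct_alt)
    case base
    have "\<zero>\<^bsub>Adj\<^esub> = Lam 0" unfolding Adj_zero by (rule oper_cong) simp
    then show ?case using theta_span.zero[of X] subspace_0[OF subspace_U] by metis
  next
    case (step r x y)
    then obtain e f where x: "x = e * adj f" "e \<in> E" "f \<in> E" by blast
    have y: "y \<in> U" using step by blast
    then have "r *\<^sub>R x + y \<in> U"
      unfolding x(1) by (intro subspace_add subspace_scale subspace_U rank_one_in_U x)
    moreover
    have "(complex_of_real r *\<^sub>C e) * adj f \<in> U" by (intro rank_one_in_U E_scaleC x)
    moreover from this have "cscale Adj (complex_of_real r) (theta X (cls e) (cls f)) \<oplus>\<^bsub>Adj\<^esub> Lam y
        = Lam (r *\<^sub>R x + y)"
      using x y by (simp add: theta_eq Lam_cscale rank_one_in_U Lam_add mult_scaleC_left scaleR_eq_scaleC)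
    moreover have "cscale Adj (complex_of_real r) (theta X (cls e) (cls f)) \<oplus>\<^bsub>Adj\<^esub> Lam y \<in> theta_span X"
      using step x by (intro theta_span.add) (auto simp: cls_in_hcarrier)
    ultimately show ?case by simp
  qed
  then show "t \<in> theta_span X" using m by simp
qed

text \<open>If \<open>T\<close> is approximated by \<open>Lam (m n)\<close>, the differences of the
  \<open>m n\<close> are small on \<open>E\<close> and therefore small in norm by
  \<open>K_norm_le\<close>. The \<open>m n\<close> thus converge to some \<open>k\<close> in
  \<open>K\<close>, and \<open>k\<close> implements \<open>T\<close>.\<close>

lemma compacts_eq: "compacts X = Lam ` K"
proof (intro equalityI subsetI)
  fix t assume "t \<in> Lam ` K"
  then obtain k where k: "t = Lam k" "k \<in> K" by blast
  then have kU: "k \<in> U" using K_subset_U by blast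
  have "\<exists>s\<in>theta_span X. cnorm Adj (t \<ominus>\<^bsub>Adj\<^esub> s) < \<epsilon>" if "\<epsilon> > 0" for \<epsilon>
  proof -
    obtain m where m: "m \<in> M" "dist m k < \<epsilon>"
      using k(2) \<open>\<epsilon> > 0\<close> unfolding K_def closure_approachable by blast
    have mU: "m \<in> U" using m(1) M_subset_K K_subset_U by blast
    have "k - m \<in> U" using kU mU subspace_U by (auto intro: subspace_diff)
    then have "cnorm Adj (t \<ominus>\<^bsub>Adj\<^esub> Lam m) \<le> norm (k - m)"
      using k kU mU by (simp add: Lam_minus cnorm_Lam_le)
    also have "\<dots> < \<epsilon>" using m(2) by (simp add: dist_norm norm_minus_commute)
    finally show ?thesis using m(1) by (auto simp: theta_span_eq)
  qed
  then show "t \<in> compacts X" using Lam_in_carrier[OF kU] k by (simp add: compacts_def)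
next
  fix t assume t: "t \<in> compacts X"
  then obtain T where T: "t = oper T" "adjointable T" by (auto simp: compacts_def carrier_Adj)
  have "\<exists>m\<in>M. cnorm Adj (t \<ominus>\<^bsub>Adj\<^esub> Lam m) < 1 / real (Suc n)" for n
    using t by (simp add: compacts_def theta_span_eq)
  then obtain m where m: "\<And>n. m n \<in> M" "\<And>n. cnorm Adj (t \<ominus>\<^bsub>Adj\<^esub> Lam (m n)) < 1 / real (Suc n)"
    by metis
  have mU: "m n \<in> U" for n using m(1) M_subset_K K_subset_U by blast
  have approx: "norm (T e - m n * e) \<le> 1 / real (Suc n) * norm e" if e: "e \<in> E" for n e
  proof -
    have "adjointable (\<lambda>e. T e + - (m n * e))"
      by (rule adjointable_add[OF T(2) adjointable_uminus[OF adjointable_U[OF mU]]])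
    then have "norm (T e - m n * e) \<le> cnorm Adj (oper (\<lambda>e. T e - m n * e)) * norm e"
      using cnorm_Adj_bound[OF _ e, of "\<lambda>e. T e - m n * e"] by simp
    also have "\<dots> \<le> 1 / real (Suc n) * norm e"
      using m(2)[of n] by (intro mult_right_mono) (auto simp: T Adj_minus[OF T(2) adjointable_U[OF mU]])
    finally show ?thesis .
  qed
  have close: "norm (m n - m j) \<le> 1 / real (Suc n) + 1 / real (Suc j)" for n j
  proof (rule K_norm_le)
    show "m n - m j \<in> K" using m(1) M_subset_K by (auto intro!: diff_in_K)
    fix e assume e: "e \<in> E"
    have "norm ((T e - m j * e) - (T e - m n * e)) \<le> 1 / real (Suc j) * norm e + 1 / real (Suc n) * norm e"
      using norm_triangle_ineq4[of "T e - m j * e" "T e - m n * e"] approx[OF e, of j] approx[OF e, of n]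
      by linarith
    then show "norm ((m n - m j) * e) \<le> (1 / real (Suc n) + 1 / real (Suc j)) * norm e"
      by (simp add: algebra_simps)
  qed simp
  have "Cauchy m"
  proof (rule CauchyI)
    fix \<epsilon> :: real assume "\<epsilon> > 0"
    then obtain N where N: "1 / real (Suc N) < \<epsilon> / 2"
      using reals_Archimedean[of "\<epsilon> / 2"] by (auto simp: inverse_eq_divide)
    have "norm (m n - m j) < \<epsilon>" if "n \<ge> N" "j \<ge> N" for n j
    proof -
      have "1 / real (Suc n) \<le> 1 / real (Suc N)" "1 / real (Suc j) \<le> 1 / real (Suc N)"
        using that by (auto intro!: divide_left_mono)
      then show ?thesis using close[of n j] N by linarith
    qed
    then show "\<exists>N. \<forall>n\<ge>N. \<forall>j\<ge>N. norm (m n - m j) < \<epsilon>" by blast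
  qed
  then obtain k where k: "m \<longlonglongrightarrow> k" by (auto simp: Cauchy_convergent_iff convergent_def)
  have "k \<in> K" using closed_sequentially[OF closed_K _ k] m(1) M_subset_K by blast
  moreover have "T e = k * e" if e: "e \<in> E" for e
  proof -
    have "(\<lambda>n. 1 / real (Suc n) * norm e) \<longlonglongrightarrow> 0 * norm e"
      by (intro tendsto_intros LIMSEQ_Suc lim_1_over_n)
    then have "(\<lambda>n. 1 / real (Suc n) * norm e) \<longlonglongrightarrow> 0" by (simp only: mult_zero_left)
    then have "(\<lambda>n. T e - m n * e) \<longlonglongrightarrow> 0"
      by (rule Lim_null_comparison[OF always_eventually[OF allI[OF approx[OF e]]]])
    moreover have "(\<lambda>n. T e - m n * e) \<longlonglongrightarrow> T e - k * e" by (intro tendsto_intros k)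
    ultimately have "0 = T e - k * e" by (rule LIMSEQ_unique)
    then show ?thesis by simp
  qed
  then have "t = Lam k" unfolding T(1) by (rule oper_cong)
  ultimately show "t \<in> Lam ` K" by blast
qed

lemma left_op_eq: "left_op X a = Lam (iA a)"
  unfolding left_op_def oper_def
  by (rule restrict_ext) (auto simp: hcarrier_eq hleft_eq un_cls)

lemma Lam_eq_iff: "k \<in> U \<Longrightarrow> l \<in> U \<Longrightarrow> Lam k = Lam l \<longleftrightarrow> (\<forall>e\<in>E. k * e = l * e)"
  by (simp add: oper_eq_iff U_image)

lemma inj_on_Lam: "inj_on Lam K"
proof (rule inj_onI)
  fix k l assume kl: "k \<in> K" "l \<in> K" "Lam k = Lam l"
  then have "\<forall>e\<in>E. k * e = l * e" using Lam_eq_iff K_subset_U by blast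
  then have "norm ((k - l) * e) \<le> 0 * norm e" if "e \<in> E" for e
    using that by (simp only: left_diff_distrib) simp
  then have "norm (k - l) \<le> 0" by (rule K_norm_le[OF diff_in_K[OF kl(1,2)] order_refl])
  then show "k = l" by simp
qed

end

section \<open>Covariant representations and redundancies\<close>

text \<open>A density argument for maps known only on \<open>W\<close>. It gives uniqueness in both
  definite descriptions: for \<open>psi_map\<close> with \<open>W = E\<close>, and for
  \<open>induced_hom\<close> with \<open>W = K\<close> and dense part \<open>M\<close>.\<close>

lemma (in unital_cstar) star_hom_unique_on_closure:
  assumes f: "star_hom type_cstar B f" and W: "subspace W" "W0 \<subseteq> W" "W \<subseteq> closure W0"
    and G: "\<And>x. x \<in> W \<Longrightarrow> G x \<in> carrier B"
      "\<And>x y. x \<in> W \<Longrightarrow> y \<in> W \<Longrightarrow> G (x + y) = G x \<oplus> G y"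
      "\<And>x. x \<in> W \<Longrightarrow> cnorm B (G x) \<le> C * norm x"
    and eq: "\<And>x. x \<in> W0 \<Longrightarrow> G x = f x" and x: "x \<in> W"
  shows "G x = f x"
proof (rule eq_if_cnorm_diff_small)
  show "G x \<in> carrier B" "f x \<in> carrier B" using G(1) x star_hom_typeD(1)[OF f] by auto
  fix e :: real assume e: "e > 0"
  \<comment> \<open>\<open>\<bar>C\<bar> + 1\<close> adds the Lipschitz constants of
    \<open>G\<close> and of the contractive \<open>f\<close>.\<close>
  define d where "d = e / (\<bar>C\<bar> + 1)"
  have d: "d > 0" using e by (simp add: d_def add_nonneg_pos)
  then obtain y where y: "y \<in> W0" "norm (y - x) < d"
    using x W(3) by (metis closure_approachable dist_norm subsetD)
  have yW: "y \<in> W" and xy: "x - y \<in> W" using y W x by (auto intro: subspace_diff)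
  have "G x = G (x - y) \<oplus> G y" using G(2)[OF xy yW] by simp
  then have "G x \<ominus> G y = G (x - y)"
    using G(1)[OF xy] G(1)[OF yW] by (metis add.inv_solve_right' a_minus_def G(1) x)
  then have "cnorm B (G x \<ominus> G y) \<le> C * norm (x - y)" using G(3)[OF xy] by simp
  moreover have "C * norm (x - y) \<le> \<bar>C\<bar> * norm (x - y)" by (intro mult_right_mono) auto
  moreover have "cnorm B (f y \<ominus> f x) \<le> norm (y - x)"
    using star_hom_contractive[OF f, of "y - x"] by (simp add: star_hom_diff[OF f])
  moreover have "cnorm B (G x \<ominus> f x) \<le> cnorm B (G x \<ominus> G y) + cnorm B (f y \<ominus> f x)"
    using cnorm_diff_triangle[of "G x" "G y" "f x"] G(1)[OF x] G(1)[OF yW] eq[OF y(1)]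
      star_hom_typeD(1)[OF f] by simp
  ultimately have "cnorm B (G x \<ominus> f x) \<le> (\<bar>C\<bar> + 1) * norm (y - x)"
    by (simp add: distrib_right norm_minus_commute)
  also have "\<dots> \<le> (\<bar>C\<bar> + 1) * d" using y(2) by (intro mult_left_mono) auto
  also have "\<dots> = e" by (simp add: d_def)
  finally show "cnorm B (G x \<ominus> f x) \<le> e" .
qed

context faithful_toeplitz_rep
begin

text \<open>The restriction of \<open>f\<close> to \<open>E\<close> meets every clause of the
  definite description, with bound 1 since \<open>f\<close> is contractive; the values on the dense
  set of all \<open>iA a * S\<close> exclude any other map.\<close>

lemma psi_map_eq:
  fixes B :: "'b cstar"
  assumes B: "unital_cstar B" and f: "star_hom type_cstar B f"
  shows "psi_map \<alpha> L B (f \<circ> iA) (f S) = (\<lambda>x\<in>hcarrier X. f (un x))"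
proof -
  interpret B: unital_cstar B by (rule B)
  note D = star_hom_typeD[OF f]
  show ?thesis
    unfolding psi_map_def Let_def
  proof (rule the_equality)
    let ?\<psi> = "\<lambda>x\<in>hcarrier X. f (un x)"
    show "?\<psi> \<in> hcarrier X \<rightarrow>\<^sub>E carrier B \<and>
       (\<forall>x\<in>hcarrier X. \<forall>y\<in>hcarrier X. ?\<psi> (hadd X x y) = ?\<psi> x \<oplus>\<^bsub>B\<^esub> ?\<psi> y) \<and>
       (\<forall>c. \<forall>x\<in>hcarrier X. ?\<psi> (hscale X c x) = cscale B c (?\<psi> x)) \<and>
       (\<exists>C. \<forall>x\<in>hcarrier X. cnorm B (?\<psi> x) \<le> C * hnorm X x) \<and>
       (\<forall>a. ?\<psi> (bimod_q L a) = (f \<circ> iA) a \<otimes>\<^bsub>B\<^esub> f S)"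
    proof (intro conjI)
      show "\<exists>C. \<forall>x\<in>hcarrier X. cnorm B (?\<psi> x) \<le> C * hnorm X x"
        using B.star_hom_contractive[OF f]
        by (intro exI[of _ 1]) (auto simp: hcarrier_eq un_cls hnorm_eq)
    qed (auto simp: hcarrier_eq un_cls hadd_eq hscale_eq E_add E_scaleC D bimod_q_eq iA_S_in_E)
    fix \<psi> assume \<psi>: "\<psi> \<in> hcarrier X \<rightarrow>\<^sub>E carrier B \<and>
       (\<forall>x\<in>hcarrier X. \<forall>y\<in>hcarrier X. \<psi> (hadd X x y) = \<psi> x \<oplus>\<^bsub>B\<^esub> \<psi> y) \<and>
       (\<forall>c. \<forall>x\<in>hcarrier X. \<psi> (hscale X c x) = cscale B c (\<psi> x)) \<and>
       (\<exists>C. \<forall>x\<in>hcarrier X. cnorm B (\<psi> x) \<le> C * hnorm X x) \<and>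
       (\<forall>a. \<psi> (bimod_q L a) = (f \<circ> iA) a \<otimes>\<^bsub>B\<^esub> f S)"
    then obtain C where C: "\<And>x. x \<in> hcarrier X \<Longrightarrow> cnorm B (\<psi> x) \<le> C * hnorm X x" by blast
    have eq: "\<psi> (cls e) = f e" if "e \<in> E" for e
    proof (rule B.star_hom_unique_on_closure[where G="\<lambda>e. \<psi> (cls e)" and W=E and C=C
          and W0="range (\<lambda>a. iA a * S)", OF f subspace_E])
      show "range (\<lambda>a. iA a * S) \<subseteq> E" using iA_S_in_E by blast
      show "E \<subseteq> closure (range (\<lambda>a. iA a * S))" by (simp add: E_def)
      show "\<psi> (cls e) \<in> carrier B" if "e \<in> E" for e
        using \<psi> cls_in_hcarrier[OF that] by (auto simp: PiE_iff)
      show "\<psi> (cls (e + g)) = \<psi> (cls e) \<oplus>\<^bsub>B\<^esub> \<psi> (cls g)" if "e \<in> E" "g \<in> E" for e g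
        using \<psi> cls_in_hcarrier that by (auto simp: hadd_eq[symmetric])
      show "cnorm B (\<psi> (cls e)) \<le> C * norm e" if "e \<in> E" for e
        using C[OF cls_in_hcarrier[OF that]] that by (simp add: hnorm_eq)
      show "\<psi> (cls e) = f e" if "e \<in> range (\<lambda>a. iA a * S)" for e
        using \<psi> that by (auto simp: bimod_q_eq D)
    qed (rule that)
    show "\<psi> = ?\<psi>"
    proof (rule extensionalityI[of _ "hcarrier X"])
      show "\<psi> \<in> extensional (hcarrier X)" using \<psi> by (simp add: PiE_def)
    qed (auto simp: hcarrier_eq eq un_cls)
  qed
qed

text \<open>The candidate is \<open>f\<close> composed with the inverse of \<open>Lam\<close> on
  \<open>K\<close>; it is contractive as \<open>Lam\<close> is isometric there. Any other candidate
  agrees with it on the span \<open>M\<close> through its values at the \<open>theta X x y\<close>,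
  and then on \<open>K\<close> by continuity.\<close>

lemma induced_hom_Lam:
  fixes B :: "'b cstar"
  assumes B: "unital_cstar B" and f: "star_hom type_cstar B f" and k: "k \<in> K"
  shows "induced_hom X B (\<lambda>x\<in>hcarrier X. f (un x)) (Lam k) = f k"
proof -
  interpret B: unital_cstar B by (rule B)
  note D = star_hom_typeD[OF f]
  let ?\<psi> = "\<lambda>x\<in>hcarrier X. f (un x)"
  define F where "F = (\<lambda>t\<in>compacts X. f (the_inv_into K Lam t))"
  have F: "F (Lam k) = f k" if "k \<in> K" for k
    using that by (simp add: F_def compacts_eq the_inv_into_f_f[OF inj_on_Lam])
  have KU: "k \<in> U" if "k \<in> K" for k using that K_subset_U by blast
  have "induced_hom X B ?\<psi> = F"
    unfolding induced_hom_def
  proof (rule the_equality)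
    show "F \<in> extensional (compacts X) \<and> star_hom (Adj\<lparr>carrier := compacts X\<rparr>) B F \<and>
      (\<forall>t\<in>compacts X. cnorm B (F t) \<le> cnorm Adj t) \<and>
      (\<forall>x\<in>hcarrier X. \<forall>y\<in>hcarrier X. F (theta X x y) = ?\<psi> x \<otimes>\<^bsub>B\<^esub> cadj B (?\<psi> y))"
    proof (intro conjI)
      show "star_hom (Adj\<lparr>carrier := compacts X\<rparr>) B F"
        unfolding star_hom_def
        by (auto simp: compacts_eq F KU D Lam_add Lam_mult Lam_cscale Lam_cadj add_in_K mult_in_K
            scaleC_in_K adj_in_K)
      show "\<forall>t\<in>compacts X. cnorm B (F t) \<le> cnorm Adj t"
        using B.star_hom_contractive[OF f] by (auto simp: compacts_eq F norm_eq_cnorm_Lam)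
      show "\<forall>x\<in>hcarrier X. \<forall>y\<in>hcarrier X. F (theta X x y) = ?\<psi> x \<otimes>\<^bsub>B\<^esub> cadj B (?\<psi> y)"
        by (auto simp: hcarrier_eq theta_eq F rank_one_in_K D un_cls)
    qed (simp add: F_def)
    fix F' assume F': "F' \<in> extensional (compacts X) \<and> star_hom (Adj\<lparr>carrier := compacts X\<rparr>) B F' \<and>
      (\<forall>t\<in>compacts X. cnorm B (F' t) \<le> cnorm Adj t) \<and>
      (\<forall>x\<in>hcarrier X. \<forall>y\<in>hcarrier X. F' (theta X x y) = ?\<psi> x \<otimes>\<^bsub>B\<^esub> cadj B (?\<psi> y))"
    define G where "G k = F' (Lam k)" for k
    have G: "G k \<in> carrier B" "G (k + l) = G k \<oplus>\<^bsub>B\<^esub> G l" "G (c *\<^sub>C k) = cscale B c (G k)"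
      if "k \<in> K" "l \<in> K" for k l c
      using F' that by (auto simp: star_hom_def G_def compacts_eq Lam_add[symmetric] KU Lam_cscale[symmetric])
    have G0: "G 0 = \<zero>\<^bsub>B\<^esub>"
      using G(1,2)[of 0 0] subspace_0[OF subspace_K] by simp
    have GM: "m \<in> K \<and> G m = f m" if "m \<in> M" for m
      using that unfolding M_def
    proof (induction rule: span_induct_alt)
      case base
      then show ?case using G0 subspace_0[OF subspace_K] by (simp add: B.star_hom_zero[OF f])
    next
      case (step r x y)
      then obtain e g where x: "x = e * adj g" "e \<in> E" "g \<in> E" by blast
      then have xK: "x \<in> K" by (simp add: rank_one_in_K)
      have "F' (theta X (cls e) (cls g)) = ?\<psi> (cls e) \<otimes>\<^bsub>B\<^esub> cadj B (?\<psi> (cls g))"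
        using F' x cls_in_hcarrier by blast
      then have "G x = f x" using x by (simp add: G_def theta_eq cls_in_hcarrier un_cls D)
      then show ?case using step xK scaleC_in_K[OF xK]
        by (simp add: scaleR_eq_scaleC add_in_K G D)
    qed
    have "G k = f k" if "k \<in> K" for k
    proof (rule B.star_hom_unique_on_closure[OF f subspace_K M_subset_K, where C=1])
      show "K \<subseteq> closure M" by (simp add: K_def)
      show "cnorm B (G k) \<le> 1 * norm k" if "k \<in> K" for k
        using F' that by (simp add: G_def compacts_eq norm_eq_cnorm_Lam[symmetric])
    qed (use that G GM in blast)+
    then show "F' = F"
      using F' by (intro extensionalityI[of _ "compacts X"]) (auto simp: compacts_eq G_def F_def the_inv_into_f_f[OF inj_on_Lam])
  qed
  then show ?thesis using F[OF k] by simp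
qed

text \<open>The equation required on the elements \<open>iA b * S\<close> is a closed condition and
  so extends to \<open>E\<close>; for elements of \<open>U\<close>, agreement on \<open>E\<close> is
  equality of operators.\<close>

lemma redundancy_iff: "redundancy iA S a k \<longleftrightarrow> k \<in> K \<and> left_op X a = Lam k"
proof -
  have "(\<forall>b. iA a * iA b * S = k * iA b * S) \<longleftrightarrow> (\<forall>e\<in>E. iA a * e = k * e)" (is "?l \<longleftrightarrow> ?r")
  proof
    assume l: ?l
    have "range (\<lambda>b. iA b * S) \<subseteq> {e. iA a * e = k * e}"
      using l by (auto simp: mult.assoc)
    moreover have "closed {e. iA a * e = k * e}"
      by (intro closed_Collect_eq continuous_intros)
    ultimately show ?r unfolding E_def using closure_minimal by blast
  next
    assume ?r
    then show ?l using iA_S_in_E by (metis mult.assoc)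
  qed
  then have "redundancy iA S a k \<longleftrightarrow> k \<in> K \<and> (\<forall>e\<in>E. iA a * e = k * e)"
    unfolding redundancy_def K_eq[symmetric] by blast
  then show ?thesis
    using Lam_eq_iff[OF iA_in_U, of k a] K_subset_U unfolding left_op_eq by blast
qed

lemma K_alpha_iff: "a \<in> K_alpha \<alpha> L \<longleftrightarrow> a \<in> range_ideal \<alpha> \<and> (\<exists>k. redundancy iA S a k)"
  by (auto simp: K_alpha_def J_ideal_def compacts_eq redundancy_iff)

text \<open>If \<open>(a, k)\<close> is a redundancy and \<open>x = a - k\<close>, then \<open>x E = 0\<close> and \<open>x x\<^sup>* E \<subseteq> x E\<close>, whence
  \<open>x\<^sup>* E = 0\<close> by the C*-identity.\<close>

lemma redundancy_adj:
  assumes "redundancy iA S a k"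
  shows "redundancy iA S (adj a) (adj k)"
proof -
  have k: "k \<in> K" and ak: "\<And>e. e \<in> E \<Longrightarrow> iA a * e = k * e"
    using assms Lam_eq_iff[OF iA_in_U, of k a] K_subset_U
    by (auto simp: redundancy_iff left_op_eq)
  have ak': "iA (adj a) * e = adj k * e" if e: "e \<in> E" for e
  proof -
    let ?d = "iA (adj a) * e - adj k * e"
    have "adj k \<in> U" using adj_in_K[OF k] K_subset_U by blast
    then have d: "?d \<in> E" using e by (auto simp: U_def intro!: E_diff E_left)
    have "adj ?d * ?d = adj e * (iA a * ?d - k * ?d)"
      by (simp add: adj_diff adj_mult adj_adj iA_simps algebra_simps)
    also have "\<dots> = 0" by (simp add: ak[OF d])
    finally show ?thesis using adj_mult_self_eq_0[of ?d] by simp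
  qed
  have "adj k \<in> K" "adj k \<in> U" using adj_in_K[OF k] K_subset_U by auto
  then show ?thesis using Lam_eq_iff[OF iA_in_U, of "adj k" "adj a"] ak'
    by (simp add: redundancy_iff left_op_eq)
qed

end

section \<open>Exel's ideal and its vanishing under covariant representations\<close>

lemma range_ideal_adj:
  fixes \<alpha> :: "'a::unital_cstar_algebra \<Rightarrow> 'a"
  assumes \<alpha>: "star_hom type_cstar type_cstar \<alpha>" and a: "a \<in> range_ideal \<alpha>"
  shows "adj a \<in> range_ideal \<alpha>"
proof -
  interpret adj: bounded_linear "adj :: 'a \<Rightarrow> 'a" by (rule bounded_linear_adj)
  let ?G = "{a * \<alpha> b * c |a b c. True}"
  have "adj (a * \<alpha> b * c) \<in> range_ideal \<alpha>" for a b c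
  proof -
    have "adj (a * \<alpha> b * c) = adj c * \<alpha> (adj b) * adj a"
      using star_hom_typeD(5)[OF \<alpha>, of b] by (simp add: adj_mult mult.assoc)
    then have "adj (a * \<alpha> b * c) \<in> ?G" by blast
    then show ?thesis unfolding range_ideal_def
      by (intro subsetD[OF closure_subset] span_base)
  qed
  then have "?G \<subseteq> adj -` range_ideal \<alpha>" by blast
  then have "span ?G \<subseteq> adj -` range_ideal \<alpha>"
    by (rule span_minimal)
      (intro linear_subspace_vimage adj.linear, simp add: range_ideal_def subspace_closure)
  moreover have "closed (adj -` range_ideal \<alpha>)"
    by (intro closed_vimage adj.continuous_on continuous_on_id) (simp add: range_ideal_def)
  ultimately have "range_ideal \<alpha> \<subseteq> adj -` range_ideal \<alpha>"
    unfolding range_ideal_def[of \<alpha>] by (rule closure_minimal)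
  then show ?thesis using a by blast
qed

text \<open>Negatives are multiples by \<open>- 1\<close>, hence no clause for them.\<close>

lemma ideal_type_cstar_iff:
  "ideal I (type_cstar :: 'a::unital_cstar_algebra cstar) \<longleftrightarrow>
    0 \<in> I \<and> (\<forall>x\<in>I. \<forall>y\<in>I. x + y \<in> I) \<and> (\<forall>x\<in>I. \<forall>y. y * x \<in> I \<and> x * y \<in> I)"
proof
  assume I: "ideal I (type_cstar :: 'a cstar)"
  interpret ideal I "type_cstar :: 'a cstar" by (rule I)
  show "0 \<in> I \<and> (\<forall>x\<in>I. \<forall>y\<in>I. x + y \<in> I) \<and> (\<forall>x\<in>I. \<forall>y. y * x \<in> I \<and> x * y \<in> I)"
    using additive_subgroup.zero_closed[OF is_additive_subgroup]
      additive_subgroup.a_closed[OF is_additive_subgroup] I_l_closed I_r_closed by auto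
next
  assume I: "0 \<in> I \<and> (\<forall>x\<in>I. \<forall>y\<in>I. x + y \<in> I) \<and> (\<forall>x\<in>I. \<forall>y. y * x \<in> I \<and> x * y \<in> I)"
  interpret ring "type_cstar :: 'a cstar" by (rule ring_type_cstar)
  show "ideal I (type_cstar :: 'a cstar)"
  proof (rule idealI[OF ring_type_cstar])
    show "subgroup I (add_monoid (type_cstar :: 'a cstar))"
    proof (rule add.subgroupI)
      fix x assume "x \<in> I"
      have "\<ominus>\<^bsub>type_cstar\<^esub> x = (- 1) * x"
        using l_neg[of x] by (simp add: eq_neg_iff_add_eq_0)
      moreover have "(- 1) * x \<in> I" using I \<open>x \<in> I\<close> by blast
      ultimately show "\<ominus>\<^bsub>type_cstar\<^esub> x \<in> I" by metis
    qed (use I in auto)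
  qed (use I in auto)
qed

lemma ideal_adj_vimage:
  fixes I :: "'a::unital_cstar_algebra set"
  assumes "ideal I type_cstar"
  shows "ideal (adj -` I) type_cstar"
  using assms by (simp add: ideal_type_cstar_iff adj_add adj_mult)

context faithful_toeplitz_rep
begin

text \<open>Self-adjointness comes from minimality: if \<open>I\<close> is a closed ideal containing
  the generators, so is its preimage under \<open>adj\<close>, because adjoints of redundancies are
  redundancies and \<open>range_ideal \<alpha>\<close> is self-adjoint.\<close>

lemma closed_star_ideal_exel_ideal:
  assumes \<alpha>: "star_hom type_cstar type_cstar \<alpha>"
  shows "closed_star_ideal (exel_ideal \<alpha> iA S)"
proof -
  let ?R = "{iA a - k |a k. a \<in> range_ideal \<alpha> \<and> redundancy iA S a k}"
  have "ideal (exel_ideal \<alpha> iA S) type_cstar"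
    by (auto simp: exel_ideal_def ideal_type_cstar_iff)
  moreover have "closed (exel_ideal \<alpha> iA S)" by (auto simp: exel_ideal_def)
  moreover have "adj x \<in> exel_ideal \<alpha> iA S" if x: "x \<in> exel_ideal \<alpha> iA S" for x
    unfolding exel_ideal_def
  proof (rule InterI)
    fix I assume "I \<in> {I. ideal I type_cstar \<and> closed I \<and> ?R \<subseteq> I}"
    then have I: "ideal I type_cstar" "closed I" "?R \<subseteq> I" by auto
    have "closed (adj -` I)"
      by (intro closed_vimage I bounded_linear.continuous_on[OF bounded_linear_adj] continuous_on_id)
    moreover have "?R \<subseteq> adj -` I"
    proof clarify
      fix a k assume "a \<in> range_ideal \<alpha>" "redundancy iA S a k"
      then have "iA (adj a) - adj k \<in> ?R" using range_ideal_adj[OF \<alpha>] redundancy_adj by blast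
      then show "iA a - k \<in> adj -` I" using I(3) by (auto simp: adj_diff iA_simps)
    qed
    ultimately have "x \<in> adj -` I"
      using x ideal_adj_vimage[OF I(1)] by (auto simp: exel_ideal_def)
    then show "adj x \<in> I" by simp
  qed
  ultimately show ?thesis by (simp add: closed_star_ideal_def closed_star_ideal_axioms_def)
qed

lemma redundancy_in_exel_ideal:
  "a \<in> range_ideal \<alpha> \<Longrightarrow> redundancy iA S a k \<Longrightarrow> iA a - k \<in> exel_ideal \<alpha> iA S"
  by (auto simp: exel_ideal_def)

text \<open>Evaluates the right-hand side of the covariance condition: at \<open>a\<close> it
  becomes \<open>f (iA a) = f k\<close>, so that \<open>f\<close> kills
  \<open>iA a - k\<close>.\<close>

lemma covariance_redundancy:
  fixes B :: "'b cstar"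
  assumes "unital_cstar B" "star_hom type_cstar B f" "redundancy iA S a k"
  shows "induced_hom X B (psi_map \<alpha> L B (f \<circ> iA) (f S)) (left_op X a) = f k"
  using assms by (simp add: psi_map_eq redundancy_iff induced_hom_Lam)

text \<open>The kernel of \<open>f\<close> is an ideal, closed since \<open>f\<close> is
  contractive, and by covariance it contains the generators.\<close>

lemma star_hom_vanishes_on_exel_ideal:
  fixes B :: "'b cstar"
  assumes B: "unital_cstar B" and f: "star_hom type_cstar B f"
    and cov: "covariant_rep \<alpha> L B (f \<circ> iA) (f S)" and x: "x \<in> exel_ideal \<alpha> iA S"
  shows "f x = \<zero>\<^bsub>B\<^esub>"
proof -
  interpret B: unital_cstar B by (rule B)
  note D = star_hom_typeD[OF f]
  let ?I = "{x. f x = \<zero>\<^bsub>B\<^esub>}"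
  have "ideal ?I type_cstar"
    by (simp add: ideal_type_cstar_iff D B.star_hom_zero[OF f])
  moreover have "closed ?I"
    unfolding closed_sequential_limits
  proof (intro allI impI, elim conjE)
    fix u l assume u: "\<forall>n. u n \<in> ?I" "u \<longlonglongrightarrow> l"
    have "f l = \<zero>\<^bsub>B\<^esub>"
    proof (rule B.eq_if_cnorm_diff_small)
      fix e :: real assume "e > 0"
      then obtain n where "norm (u n - l) < e" using LIMSEQ_D[OF u(2)] by blast
      moreover have "cnorm B (f (l - u n)) \<le> norm (l - u n)" by (rule B.star_hom_contractive[OF f])
      moreover have "f (l - u n) = f l \<ominus>\<^bsub>B\<^esub> \<zero>\<^bsub>B\<^esub>" using u(1) by (simp add: B.star_hom_diff[OF f])
      ultimately show "cnorm B (f l \<ominus>\<^bsub>B\<^esub> \<zero>\<^bsub>B\<^esub>) \<le> e" by (simp add: norm_minus_commute)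
    qed (simp_all add: D)
    then show "l \<in> ?I" by simp
  qed
  moreover have "{iA a - k |a k. a \<in> range_ideal \<alpha> \<and> redundancy iA S a k} \<subseteq> ?I"
  proof clarify
    fix a k assume a: "a \<in> range_ideal \<alpha>" and r: "redundancy iA S a k"
    then have "a \<in> K_alpha \<alpha> L" by (auto simp: K_alpha_iff)
    then have "f (iA a) = f k"
      using cov covariance_redundancy[OF B f r] by (auto simp: covariant_rep_def)
    then show "f (iA a - k) = \<zero>\<^bsub>B\<^esub>"
      by (simp add: B.star_hom_diff[OF f] D a_minus_def B.r_neg)
  qed
  ultimately show ?thesis using x unfolding exel_ideal_def by blast
qed

lemma toeplitz_covariant_rep_star_hom:
  assumes B: "unital_cstar B" and f: "star_hom type_cstar B f" and f1: "f 1 = \<one>\<^bsub>B\<^esub>"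
  shows "toeplitz_covariant_rep \<alpha> L B (f \<circ> iA) (f S)"
proof -
  note D = star_hom_typeD[OF f]
  have "star_hom type_cstar B (f \<circ> iA)" by (simp add: star_hom_def D iA_simps)
  then show ?thesis using B
    by (simp add: toeplitz_covariant_rep_def iA_one f1 D S_iA flip: D(3,5) adj_S_iA)
qed

lemma covariant_rep_crossed_product:
  assumes \<alpha>: "star_hom type_cstar type_cstar \<alpha>"
  shows "covariant_rep \<alpha> L (crossed_product \<alpha> iA S) (crossed_map \<alpha> iA S \<circ> iA) (crossed_map \<alpha> iA S S)"
proof -
  interpret I: closed_star_ideal "exel_ideal \<alpha> iA S" by (rule closed_star_ideal_exel_ideal[OF \<alpha>])
  let ?Q = "quotient_map (exel_ideal \<alpha> iA S)" and ?B = "quotient_cstar (exel_ideal \<alpha> iA S)"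
  note Q = I.unital_cstar_quotient I.star_hom_quotient_map
  have "?Q (iA a) = induced_hom X ?B (psi_map \<alpha> L ?B (?Q \<circ> iA) (?Q S)) (left_op X a)"
    if a: "a \<in> K_alpha \<alpha> L" for a
  proof -
    obtain k where k: "redundancy iA S a k" and "a \<in> range_ideal \<alpha>"
      using a by (auto simp: K_alpha_iff)
    then have "?Q (iA a) = ?Q k" by (simp add: I.quotient_map_eq_iff redundancy_in_exel_ideal)
    then show ?thesis using covariance_redundancy[OF Q k] by simp
  qed
  then show ?thesis
    using toeplitz_covariant_rep_star_hom[OF Q] I.quotient_cstar_simps(4)
    by (simp add: covariant_rep_def crossed_product_def crossed_map_def)
qed

end

theorem proposition3p9:
  fixes \<alpha> L :: "'a::unital_cstar_algebra \<Rightarrow> 'a"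
    and iA :: "'a \<Rightarrow> 't::unital_cstar_algebra" and S :: 't
  assumes "star_hom type_cstar type_cstar \<alpha>"
    and "transfer_operator \<alpha> L"
    and "toeplitz_algebra TYPE('b) \<alpha> L iA S"
  shows "covariant_rep \<alpha> L (crossed_product \<alpha> iA S) (crossed_map \<alpha> iA S \<circ> iA) (crossed_map \<alpha> iA S S) \<and>
    (\<forall>(B :: 'b cstar) \<rho> V. covariant_rep \<alpha> L B \<rho> V \<longrightarrow>
      (\<exists>\<tau>. star_hom (crossed_product \<alpha> iA S) B \<tau> \<and>
           \<tau> \<circ> (crossed_map \<alpha> iA S \<circ> iA) = \<rho> \<and> \<tau> (crossed_map \<alpha> iA S S) = V))"
proof (intro conjI allI impI)
  interpret T: faithful_toeplitz_rep \<alpha> L iA S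
    using assms(3)
    by (auto simp: faithful_toeplitz_rep_def toeplitz_algebra_def toeplitz_covariant_rep_def)
  show "covariant_rep \<alpha> L (crossed_product \<alpha> iA S) (crossed_map \<alpha> iA S \<circ> iA) (crossed_map \<alpha> iA S S)"
    by (rule T.covariant_rep_crossed_product[OF assms(1)])
  fix B :: "'b cstar" and \<rho> V assume cov: "covariant_rep \<alpha> L B \<rho> V"
  then have rep: "toeplitz_covariant_rep \<alpha> L B \<rho> V" by (simp add: covariant_rep_def)
  then have B: "unital_cstar B" by (simp add: toeplitz_covariant_rep_def)
  \<comment> \<open>Universality presents \<open>\<rho>\<close> and \<open>V\<close> as images of
    \<open>iA\<close> and \<open>S\<close>, the form in which covariance implies vanishing on the
    ideal.\<close>
  obtain f where f: "star_hom type_cstar B f" "f \<circ> iA = \<rho>" "f S = V"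
    using assms(3)[unfolded toeplitz_algebra_def, THEN conjunct2, THEN conjunct2, THEN conjunct2,
        rule_format, OF rep] by blast
  interpret I: closed_star_ideal "exel_ideal \<alpha> iA S"
    by (rule T.closed_star_ideal_exel_ideal[OF assms(1)])
  have "f x = \<zero>\<^bsub>B\<^esub>" if "x \<in> exel_ideal \<alpha> iA S" for x
    using T.star_hom_vanishes_on_exel_ideal[OF B f(1)] cov f that by simp
  then obtain \<tau> where \<tau>: "star_hom (quotient_cstar (exel_ideal \<alpha> iA S)) B \<tau>"
      "\<And>x. \<tau> (quotient_map (exel_ideal \<alpha> iA S) x) = f x"
    using I.star_hom_quotient_lift[OF f(1) B] by metis
  then show "\<exists>\<tau>. star_hom (crossed_product \<alpha> iA S) B \<tau> \<and>
      \<tau> \<circ> (crossed_map \<alpha> iA S \<circ> iA) = \<rho> \<and> \<tau> (crossed_map \<alpha> iA S S) = V"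
    using f by (auto simp: crossed_product_def crossed_map_def comp_def)
qed

end
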